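(* Consider a non-degenerate probability measure $\mu$ supported on $[0,1]$ and symmetric about the line $u=1/2$. Assume that the associated Cramér rate function $I(u)=\sup_{\theta\in\mathbb{R}}\{\theta u-K(\theta)\}$, where $K(\theta)=\log\int e^{\theta x}\mu(dx)$ is the cumulant generating function of $\mu$, is bounded on $[0,1]$ (i.e. $I(0)=I(1)$ is finite). Take $H_1$ a single edge and $H_2$ a finite simple graph with $p\ge2$ edges, and assume that the equation $K'''(\theta)K'(\theta)=-(p-2)\left(K''(\theta)\right)^2$ admits only one zero on $\mathbb{R}$. Let $\beta_1>-\beta_2$ and $\beta_2\ge0$. For $(\beta_1,\beta_2)$ sufficiently far away from the origin, the limiting normalization constant $\psi_\infty^\beta$ of the $2$-parameter edge-weighted exponential random graph model with edge-weight distribution $\mu$ universally satisfies $\psi_\infty^\beta\asymp\beta_1+\beta_2$.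
   Context: Model: $\mathcal{G}_n$ is the set of simple edge-weighted complete labeled graphs $G_n$ on $n$ vertices (undirected, no loops or multiple edges), where the edge weights $x_{ij}$ between vertices $i$ and $j$ are iid real random variables with distribution $\mu$; this gives a probability measure $\mathbb{P}_n$ on $\mathcal{G}_n$ with expectation $\mathbb{E}_n$. The graphon of $G_n$ is the symmetric function $h^{G_n}:[0,1]^2\to[0,1]$ whose value at $(x,y)$ is the edge weight between vertices $\lceil nx\rceil$ and $\lceil ny\rceil$ (zero if these coincide, as there are no loops). For a finite simple graph $H$ with vertex set $\{1,\dots,k\}$ and edge set $E(H)$, $t(H,G_n)=\int_{[0,1]^k}\prod_{\{i,j\}\in E(H)}h^{G_n}(x_i,x_j)\,dx_1\cdots dx_k$. For real parameters $\beta=(\beta_1,\beta_2)$, the model is $\mathbb{P}_n^\beta(G_n)=\exp\left(n^2\left(\beta_1t(H_1,G_n)+\beta_2t(H_2,G_n)-\psi_n^\beta\right)\right)\mathbb{P}_n(G_n)$, with normalization constant $\psi_n^\beta=\frac{1}{n^2}\log\mathbb{E}_n\left(\exp\left(n^2(\beta_1t(H_1,G_n)+\beta_2t(H_2,G_n))\right)\right)$, and $\psi_\infty^\beta=\lim_{n\to\infty}\psi_n^\beta$. For $\beta_2\ge0$ this limit exists and $\psi_\infty^\beta=\sup_u\left(\beta_1u+\beta_2u^p-\frac12I(u)\right)$, the supremum being over all $u$ with $I(u)<\infty$. "Universally" means that the asymptotics do not depend on the particular $\mu$. The symbol $\asymp$ denotes agreement to leading order (ratio tending to $1$) as $(\beta_1,\beta_2)$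 moves far away from the origin.
   Formalization: "Far away from the origin" is read as (β1,β2) going to infinity within β1>-β2, β2≥0 with β1+β2 also tending to infinity; without this the claim fails, since along β1=-β2+c with c>0 fixed the ratio tends to 1-I(1)/(2c), not 1. *)

theory Defs
  imports "HOL-Probability.Probability"
begin

definition cumulant :: "real measure \<Rightarrow> real \<Rightarrow> real" where
  "cumulant \<mu> \<theta> = ln (\<integral>x. exp (\<theta> * x) \<partial>\<mu>)"

text \<open>The supremum may be infinite, hence the extended reals.\<close>

definition cramer_rate :: "real measure \<Rightarrow> real \<Rightarrow> ereal" where
  "cramer_rate \<mu> u = (SUP \<theta>. ereal (\<theta> * u - cumulant \<mu> \<theta>))"

text \<open>An undirected edge \<open>{i, j}\<close> is represented by the pair \<open>(i, j)\<close> with \<open>i < j\<close>.\<close>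

definition vertex_pairs :: "nat \<Rightarrow> (nat \<times> nat) set" where
  "vertex_pairs n = {(i, j). 1 \<le> i \<and> i < j \<and> j \<le> n}"

definition simple_graph :: "nat \<Rightarrow> (nat \<times> nat) set \<Rightarrow> bool" where
  "simple_graph k E \<longleftrightarrow> E \<subseteq> vertex_pairs k"

definition weighted_graph_measure ::
    "real measure \<Rightarrow> nat \<Rightarrow> (nat \<times> nat \<Rightarrow> real) measure" where
  "weighted_graph_measure \<mu> n = PiM (vertex_pairs n) (\<lambda>_. \<mu>)"

definition edge_weight :: "nat \<Rightarrow> (nat \<times> nat \<Rightarrow> real) \<Rightarrow> nat \<Rightarrow> nat \<Rightarrow> real" where
  "edge_weight n g i j =
     (if (i, j) \<in> vertex_pairs n then g (i, j)
      else if (j, i) \<in> vertex_pairs n then g (j, i)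
      else 0)"

text \<open>If one of the arguments is 0, the ceiling is 0, which is not a vertex, and the value is 0;
  this affects only a null set.\<close>

definition graphon :: "nat \<Rightarrow> (nat \<times> nat \<Rightarrow> real) \<Rightarrow> real \<Rightarrow> real \<Rightarrow> real" where
  "graphon n g x y = edge_weight n g (nat \<lceil>real n * x\<rceil>) (nat \<lceil>real n * y\<rceil>)"

text \<open>Homomorphism density of the graph with vertex set \<open>{1..k}\<close> and edge set \<open>E\<close>.\<close>

definition hom_density ::
    "nat \<Rightarrow> (nat \<times> nat) set \<Rightarrow> nat \<Rightarrow> (nat \<times> nat \<Rightarrow> real) \<Rightarrow> real" where
  "hom_density k E n g =
     (\<integral>x. (\<Prod>(i, j)\<in>E. graphon n g (x i) (x j))
        \<partial>(PiM {1..k} (\<lambda>_. restrict_space lborel {0..1::real})))"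

text \<open>Normalization constant of the model with \<open>H\<^sub>1\<close> a single edge (on the vertices 1 and 2)
  and \<open>H\<^sub>2\<close> the graph \<open>({1..k}, E)\<close>.\<close>

definition psi :: "real measure \<Rightarrow> nat \<Rightarrow> (nat \<times> nat) set \<Rightarrow> real \<times> real \<Rightarrow> nat \<Rightarrow> real" where
  "psi \<mu> k E \<beta> n =
     1 / (real n)\<^sup>2 *
       ln (\<integral>g. exp ((real n)\<^sup>2 *
              (fst \<beta> * hom_density 2 {(1, 2)} n g + snd \<beta> * hom_density k E n g))
            \<partial>(weighted_graph_measure \<mu> n))"

definition psi_inf :: "real measure \<Rightarrow> nat \<Rightarrow> (nat \<times> nat) set \<Rightarrow> real \<times> real \<Rightarrow> real" where
  "psi_inf \<mu> k E \<beta> = lim (psi \<mu> k E \<beta>)"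

text \<open>The parameters move away from the origin inside the region \<open>\<beta>\<^sub>1 > - \<beta>\<^sub>2\<close>, \<open>\<beta>\<^sub>2 \<ge> 0\<close> in
  such a way that the leading term \<open>\<beta>\<^sub>1 + \<beta>\<^sub>2\<close> grows without bound. This covers every ray and
  every line of the form \<open>\<beta>\<^sub>1 = a \<beta>\<^sub>2 + b\<close> with \<open>a > -1\<close>, and is uniform on every sector
  \<open>\<beta>\<^sub>1 \<ge> a \<beta>\<^sub>2\<close> with \<open>a > -1\<close>. The condition on \<open>\<beta>\<^sub>1 + \<beta>\<^sub>2\<close> cannot be dropped: along the
  lines \<open>\<beta>\<^sub>1 = - \<beta>\<^sub>2 + c\<close> the limiting normalization constant tends to
  \<open>max (c - I(1)/2) (- I(0)/2)\<close>, so its ratio to \<open>c\<close> does not tend to 1.\<close>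

definition far_from_origin :: "(real \<times> real) filter" where
  "far_from_origin =
     inf (inf at_infinity (principal {\<beta>. fst \<beta> > - snd \<beta> \<and> snd \<beta> \<ge> 0}))
         (filtercomap (\<lambda>\<beta>. fst \<beta> + snd \<beta>) at_top)"

end

theory Submission
  imports Defs
begin

text \<open>
  The ratio tends to 1 because \<open>\<psi>\<^sub>\<infinity>\<close> differs from \<open>\<beta>\<^sub>1 + \<beta>\<^sub>2\<close> by a bounded amount. From above, all
  weights are almost surely in \<open>[0, 1]\<close>, hence \<open>t(H\<^sub>2) \<le> t(H\<^sub>1) \<le> 1\<close>, and with \<open>\<beta>\<^sub>2 \<ge> 0\<close> and
  \<open>\<beta>\<^sub>1 + \<beta>\<^sub>2 \<ge> 0\<close> the exponent is at most \<open>n\<^sup>2 (\<beta>\<^sub>1 + \<beta>\<^sub>2)\<close>. From below, finiteness of the rate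
  function at 1 means that \<open>\<mu>\<close> has an atom at 1 (\<open>atom_of_finite_rate\<close>). All of the at most
  \<open>n (n - 1)\<close> edges then have weight 1 with probability at least \<open>\<mu>{1} ^ (n (n - 1))\<close>, and on this
  event the exponent is \<open>n\<^sup>2 (\<beta>\<^sub>1 + \<beta>\<^sub>2)\<close> to leading order. So
  \<open>\<beta>\<^sub>1 + \<beta>\<^sub>2 + ln \<mu>{1} \<le> \<psi>\<^sub>\<infinity> \<le> \<beta>\<^sub>1 + \<beta>\<^sub>2\<close>.

  These bounds say something about \<open>\<psi>\<^sub>\<infinity>\<close> only once the limit defining it is known to exist. This
  follows from monotonicity. Count only injective maps in the homomorphism densities and replace the
  factor \<open>n\<^sup>2\<close> by \<open>n (n - 1)\<close>. The resulting free energy is decreasing in \<open>n\<close>: the injective density of a graph on \<open>n + 1\<close> vertices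
  is the average of the injective densities of its \<open>n + 1\<close> vertex-deleted subgraphs
  (\<open>inj_density_Suc\<close>), each edge survives in exactly \<open>n - 1\<close> of these subgraphs, and a
  generalized Hoelder inequality of Finner and Shearer type for product measures
  (\<open>ln_integral_exp_sum_le\<close>) turns this into \<open>free_energy_Suc_le\<close>. A bounded decreasing sequence
  converges, and both changes to the exponent are of relative order \<open>O(1/n)\<close>, so that the original
  sequence has the same limit (\<open>psi_tendsto_lim_free_energy\<close>).
\<close>

section \<open>Logarithmic exponential moments and a generalized Hoelder inequality\<close>

lemma (in prob_space) integrable_exp_bounded:
  fixes h :: "'a \<Rightarrow> real"
  assumes "h \<in> borel_measurable M" "AE x in M. \<bar>h x\<bar> \<le> B"
  shows "integrable M (\<lambda>x. exp (h x))"
proof (rule integrable_const_bound[of _ "exp B"])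
  show "AE x in M. norm (exp (h x)) \<le> exp B"
    using assms(2) by eventually_elim auto
qed (use assms in measurable)

lemma (in prob_space) integral_exp_pos:
  fixes h :: "'a \<Rightarrow> real"
  assumes "h \<in> borel_measurable M" "AE x in M. \<bar>h x\<bar> \<le> B"
  shows "0 < (\<integral>x. exp (h x) \<partial>M)"
proof (rule integral_less_AE_space[of "\<lambda>_. 0", simplified])
  show "integrable M (\<lambda>x. exp (h x))" using integrable_exp_bounded assms by blast
  show "emeasure M (space M) \<noteq> 0" by (simp add: emeasure_space_1)
qed simp_all

lemma (in prob_space) ln_integral_exp_mono:
  fixes h h' :: "'a \<Rightarrow> real"
  assumes "h \<in> borel_measurable M" "AE x in M. \<bar>h x\<bar> \<le> B"
    and "h' \<in> borel_measurable M" "AE x in M. \<bar>h' x\<bar> \<le> B'"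
    and "AE x in M. h x \<le> h' x + c"
  shows "ln (\<integral>x. exp (h x) \<partial>M) \<le> ln (\<integral>x. exp (h' x) \<partial>M) + c"
proof -
  have i: "integrable M (\<lambda>x. exp (h x))" "integrable M (\<lambda>x. exp (h' x))"
    using integrable_exp_bounded assms by blast+
  have pos: "0 < (\<integral>x. exp (h x) \<partial>M)" "0 < (\<integral>x. exp (h' x) \<partial>M)"
    using integral_exp_pos assms by blast+
  have "(\<integral>x. exp (h x) \<partial>M) \<le> (\<integral>x. exp (h' x) * exp c \<partial>M)"
  proof (rule integral_mono_AE)
    show "AE x in M. exp (h x) \<le> exp (h' x) * exp c"
      using assms(5) by eventually_elim (simp flip: exp_add)
  qed (use i in auto)
  also have "\<dots> = (\<integral>x. exp (h' x) \<partial>M) * exp c" by simp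
  finally have "ln (\<integral>x. exp (h x) \<partial>M) \<le> ln ((\<integral>x. exp (h' x) \<partial>M) * exp c)"
    using pos(1) by (simp add: ln_le_cancel_iff)
  also have "\<dots> = ln (\<integral>x. exp (h' x) \<partial>M) + c"
    using pos(2) by (simp add: ln_mult)
  finally show ?thesis .
qed

lemma (in prob_space) ln_integral_exp_abs_le:
  fixes h :: "'a \<Rightarrow> real"
  assumes "h \<in> borel_measurable M" "AE x in M. \<bar>h x\<bar> \<le> B"
  shows "\<bar>ln (\<integral>x. exp (h x) \<partial>M)\<bar> \<le> B"
proof -
  have le: "AE x in M. h x \<le> 0 + B"
    using assms(2) by eventually_elim linarith
  have ge: "AE x in M. 0 \<le> h x + B"
    using assms(2) by eventually_elim linarith
  have "ln (\<integral>x. exp (h x) \<partial>M) \<le> ln (\<integral>x. exp 0 \<partial>M) + B"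
    by (rule ln_integral_exp_mono[OF assms _ _ le, of 0]) simp_all
  moreover have "ln (\<integral>x. exp 0 \<partial>M) \<le> ln (\<integral>x. exp (h x) \<partial>M) + B"
    by (rule ln_integral_exp_mono[OF _ _ assms ge, of 0]) simp_all
  ultimately show ?thesis by (simp add: prob_space abs_le_iff)
qed

text \<open>
  Hoelder's inequality for \<open>d\<close> factors, each of exponent \<open>d\<close>, together with any number of constant
  factors. After division by the right-hand side every factor \<open>exp (d h\<^sub>j)\<close> has mean 1, and
  convexity of the exponential function bounds the product by the average of these factors.
\<close>
lemma (in prob_space) integral_exp_sum_le:
  fixes h :: "'j \<Rightarrow> 'a \<Rightarrow> real"
  assumes J: "finite J" and D: "D \<subseteq> J" "card D = d" "d > 0"
    and meas: "\<And>j. j \<in> J \<Longrightarrow> h j \<in> borel_measurable M"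
    and bound: "\<And>j x. j \<in> J \<Longrightarrow> x \<in> space M \<Longrightarrow> \<bar>h j x\<bar> \<le> B"
    and const: "\<And>j x y. j \<in> J - D \<Longrightarrow> x \<in> space M \<Longrightarrow> y \<in> space M \<Longrightarrow> h j x = h j y"
  shows "(\<integral>x. exp (\<Sum>j\<in>J. h j x) \<partial>M)
           \<le> exp (\<Sum>j\<in>J. ln (\<integral>x. exp (real d * h j x) \<partial>M) / real d)"
proof -
  define L where "L j = ln (\<integral>x. exp (real d * h j x) \<partial>M) / real d" for j
  have fD: "finite D" "D \<noteq> {}" using J D finite_subset by auto
  have bd: "\<bar>real d * h j x\<bar> \<le> real d * B" if "j \<in> J" "x \<in> space M" for j x
    using bound[OF that] by (simp add: abs_mult mult_left_mono)
  have int: "integrable M (\<lambda>x. exp (real d * h j x))" if "j \<in> J" for j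
    by (rule integrable_exp_bounded[of _ "real d * B"]) (use meas bd that in auto)
  have pos: "0 < (\<integral>x. exp (real d * h j x) \<partial>M)" if "j \<in> J" for j
    by (rule integral_exp_pos[of _ "real d * B"]) (use meas bd that in auto)
  have L: "h j x = L j" if "j \<in> J - D" "x \<in> space M" for j x
  proof -
    have "(\<integral>y. exp (real d * h j y) \<partial>M) = (\<integral>y. exp (real d * h j x) \<partial>M)"
      by (rule Bochner_Integration.integral_cong) (simp_all add: const[OF that(1) _ that(2)])
    then show ?thesis using D by (simp add: L_def prob_space)
  qed
  have pointwise: "exp (\<Sum>j\<in>J. h j x)
      \<le> exp (\<Sum>j\<in>J. L j) * (\<Sum>j\<in>D. (1 / real d) * (exp (real d * h j x) / exp (real d * L j)))"
    if x: "x \<in> space M" for x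
  proof -
    have "(\<Sum>j\<in>J. h j x) - (\<Sum>j\<in>J. L j) = (\<Sum>j\<in>J. h j x - L j)"
      by (simp add: sum_subtractf)
    also have "\<dots> = (\<Sum>j\<in>D. h j x - L j)"
      using L x J D by (intro sum.mono_neutral_right) auto
    also have "\<dots> = (\<Sum>j\<in>D. (1 / real d) *\<^sub>R (real d * (h j x - L j)))"
      using D by simp
    also have "exp \<dots> \<le> (\<Sum>j\<in>D. (1 / real d) * exp (real d * (h j x - L j)))"
      by (rule convex_on_sum[OF fD exp_convex]) (use D in auto)
    also have "\<dots> = (\<Sum>j\<in>D. (1 / real d) * (exp (real d * h j x) / exp (real d * L j)))"
      by (simp add: right_diff_distrib exp_diff)
    finally have "exp (\<Sum>j\<in>J. h j x) / exp (\<Sum>j\<in>J. L j) \<le> \<dots>"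
      by (simp add: exp_diff)
    then show ?thesis by (simp add: divide_le_eq mult.commute)
  qed
  have "(\<integral>x. exp (\<Sum>j\<in>J. h j x) \<partial>M)
      \<le> (\<integral>x. exp (\<Sum>j\<in>J. L j) * (\<Sum>j\<in>D. (1 / real d) * (exp (real d * h j x) / exp (real d * L j))) \<partial>M)"
  proof (rule integral_mono)
    show "integrable M (\<lambda>x. exp (\<Sum>j\<in>J. h j x))"
    proof (rule integrable_exp_bounded[of _ "real (card J) * B"])
      show "AE x in M. \<bar>\<Sum>j\<in>J. h j x\<bar> \<le> real (card J) * B"
        by (rule AE_I2, rule order.trans[OF sum_abs sum_bounded_above]) (use bound in auto)
    qed (use meas in measurable)
    show "integrable M (\<lambda>x. exp (\<Sum>j\<in>J. L j) *
        (\<Sum>j\<in>D. (1 / real d) * (exp (real d * h j x) / exp (real d * L j))))"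
      using int D(1) by (intro integrable_mult_right Bochner_Integration.integrable_sum integrable_divide) auto
  qed (use pointwise in auto)
  also have "\<dots> = exp (\<Sum>j\<in>J. L j) * (\<Sum>j\<in>D. (1 / real d) * ((\<integral>x. exp (real d * h j x) \<partial>M) / exp (real d * L j)))"
    using int D by (simp add: subset_iff)
  also have "(\<Sum>j\<in>D. (1 / real d) * ((\<integral>x. exp (real d * h j x) \<partial>M) / exp (real d * L j))) = (\<Sum>j\<in>D. 1 / real d)"
  proof (rule sum.cong[OF refl])
    fix j assume "j \<in> D"
    then have *: "0 < (\<integral>x. exp (real d * h j x) \<partial>M)" using pos D by auto
    then have "exp (real d * L j) = (\<integral>x. exp (real d * h j x) \<partial>M)" using D(3) by (simp add: L_def)
    with * show "(1 / real d) * ((\<integral>x. exp (real d * h j x) \<partial>M) / exp (real d * L j)) = 1 / real d"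
      by (simp del: exp_ln)
  qed
  also have "\<dots> = 1" using D by simp
  finally show ?thesis by (simp add: L_def)
qed

text \<open>
  Finner's inequality for a uniform \<open>d\<close>-fold cover of the coordinates: \<open>A j\<close> contains the
  coordinates on which \<open>g j\<close> may depend. One coordinate is integrated out at a time. Hoelder's
  inequality on the fibre replaces each \<open>g j\<close> by \<open>ln (E exp (d g\<^sub>j)) / d\<close>, the expectation being
  over that coordinate. This leaves \<open>g j\<close> unchanged if it does not depend on the coordinate, so the
  cover of the remaining coordinates is the same, and \<open>E exp (d g\<^sub>j)\<close> is preserved by Fubini.
\<close>
lemma ln_integral_exp_sum_le:
  fixes g :: "'j \<Rightarrow> ('i \<Rightarrow> 'a) \<Rightarrow> real" and M :: "'i \<Rightarrow> 'a measure"
  assumes M: "\<And>i. prob_space (M i)"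
    and I: "finite I" and J: "finite J" and d: "d > 0"
    and meas: "\<And>j. j \<in> J \<Longrightarrow> g j \<in> borel_measurable (PiM I M)"
    and bound: "\<And>j x. j \<in> J \<Longrightarrow> x \<in> space (PiM I M) \<Longrightarrow> \<bar>g j x\<bar> \<le> B"
    and indep: "\<And>i j x y. j \<in> J \<Longrightarrow> i \<in> I - A j \<Longrightarrow> x \<in> space (PiM I M) \<Longrightarrow> y \<in> space (M i)
                  \<Longrightarrow> g j (x(i := y)) = g j x"
    and cover: "\<And>i. i \<in> I \<Longrightarrow> card {j \<in> J. i \<in> A j} = d"
  shows "ln (\<integral>x. exp (\<Sum>j\<in>J. g j x) \<partial>PiM I M)
           \<le> (\<Sum>j\<in>J. ln (\<integral>x. exp (real d * g j x) \<partial>PiM I M) / real d)"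
  using I meas bound indep cover
proof (induction I arbitrary: g rule: finite_induct)
  case empty
  interpret product_prob_space M by (rule product_prob_spaceI[OF M])
  have "(\<integral>x. f x \<partial>PiM {} M) = f (\<lambda>_. undefined)" for f :: "('i \<Rightarrow> 'a) \<Rightarrow> real"
    by (simp add: PiM_empty lebesgue_integral_count_space_finite)
  then show ?case using d by simp
next
  case (insert i I)
  interpret Mi: prob_space "M i" by (rule M)
  interpret PI: prob_space "PiM I M" by (rule prob_space_PiM[OF M])
  interpret PiI: prob_space "PiM (insert i I) M" by (rule prob_space_PiM[OF M])
  interpret product_prob_space M by (rule product_prob_spaceI[OF M])
  note meas[measurable] = insert.prems(1)
  have upd: "x(i := y) \<in> space (PiM (insert i I) M)" if "x \<in> space (PiM I M)" "y \<in> space (M i)" for x y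
    using that by (auto simp: space_PiM PiE_iff extensional_def)
  have upd_meas[measurable]: "(\<lambda>y. x(i := y)) \<in> M i \<rightarrow>\<^sub>M PiM (insert i I) M" if "x \<in> space (PiM I M)" for x
    by (rule measurable_fun_upd[where J=I]) (use that in auto)
  have cmeas: "(\<lambda>y. g j (x(i := y))) \<in> borel_measurable (M i)" if "j \<in> J" "x \<in> space (PiM I M)" for j x
    using that by measurable
  have cbound: "\<bar>real d * g j x\<bar> \<le> real d * B" if "j \<in> J" "x \<in> space (PiM (insert i I) M)" for j x
    using insert.prems(2)[OF that] by (simp add: abs_mult mult_left_mono)
  define g' where "g' j x = ln (\<integral>y. exp (real d * g j (x(i := y))) \<partial>M i) / real d" for j x
  have g'_meas: "g' j \<in> borel_measurable (PiM I M)" if "j \<in> J" for j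
    unfolding g'_def using that by measurable
  have g'_bound: "\<bar>g' j x\<bar> \<le> B" if "j \<in> J" "x \<in> space (PiM I M)" for j x
  proof -
    have "\<bar>ln (\<integral>y. exp (real d * g j (x(i := y))) \<partial>M i)\<bar> \<le> real d * B"
      by (rule Mi.ln_integral_exp_abs_le) (use cmeas cbound upd that in auto)
    then show ?thesis using d by (simp add: g'_def field_simps)
  qed
  have fibre: "exp (real d * g' j x) = (\<integral>y. exp (real d * g j (x(i := y))) \<partial>M i)"
    if "j \<in> J" "x \<in> space (PiM I M)" for j x
  proof -
    have "0 < (\<integral>y. exp (real d * g j (x(i := y))) \<partial>M i)"
      by (rule Mi.integral_exp_pos[of _ "real d * B"]) (use cmeas cbound upd that in auto)
    then show ?thesis using d by (simp add: g'_def)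
  qed
  have sumbound: "\<bar>\<Sum>j\<in>J. g j x\<bar> \<le> real (card J) * B" if "x \<in> space (PiM (insert i I) M)" for x
    by (rule order.trans[OF sum_abs sum_bounded_above]) (use insert.prems(2) that in auto)
  have sumbound': "\<bar>\<Sum>j\<in>J. g' j x\<bar> \<le> real (card J) * B" if "x \<in> space (PiM I M)" for x
    by (rule order.trans[OF sum_abs sum_bounded_above]) (use g'_bound that in auto)
  have int': "integrable (PiM I M) (\<lambda>x. exp (\<Sum>j\<in>J. g' j x))"
    by (rule PI.integrable_exp_bounded[of _ "real (card J) * B"]) (use sumbound' g'_meas in auto)
  have int: "integrable (PiM (insert i I) M) (\<lambda>x. exp (\<Sum>j\<in>J. g j x))"
    by (rule PiI.integrable_exp_bounded[of _ "real (card J) * B"]) (use sumbound in auto)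
  have "(\<integral>x. exp (\<Sum>j\<in>J. g j x) \<partial>PiM (insert i I) M)
      = (\<integral>x. (\<integral>y. exp (\<Sum>j\<in>J. g j (x(i := y))) \<partial>M i) \<partial>PiM I M)"
    by (rule product_integral_insert[OF insert.hyps int])
  also have "\<dots> \<le> (\<integral>x. exp (\<Sum>j\<in>J. g' j x) \<partial>PiM I M)"
  proof (rule integral_mono')
    fix x assume x: "x \<in> space (PiM I M)"
    show "(\<integral>y. exp (\<Sum>j\<in>J. g j (x(i := y))) \<partial>M i) \<le> exp (\<Sum>j\<in>J. g' j x)"
      unfolding g'_def
    proof (rule Mi.integral_exp_sum_le[OF J, of "{j\<in>J. i \<in> A j}" d])
      fix j y z assume *: "j \<in> J - {j\<in>J. i \<in> A j}" "y \<in> space (M i)" "z \<in> space (M i)"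
      show "g j (x(i := y)) = g j (x(i := z))"
        using insert.prems(3)[of j i "x(i := z)" y] * upd[OF x] by (simp del: fun_upd_apply)
    qed (use insert.prems(2) cmeas[OF _ x] upd[OF x] insert.prems(4)[of i] d in auto)
  qed (use int' in auto)
  finally have "ln (\<integral>x. exp (\<Sum>j\<in>J. g j x) \<partial>PiM (insert i I) M)
      \<le> ln (\<integral>x. exp (\<Sum>j\<in>J. g' j x) \<partial>PiM I M)"
    using PiI.integral_exp_pos[of "\<lambda>x. \<Sum>j\<in>J. g j x" "real (card J) * B"] sumbound
    by (simp add: ln_mono)
  also have "\<dots> \<le> (\<Sum>j\<in>J. ln (\<integral>x. exp (real d * g' j x) \<partial>PiM I M) / real d)"
  proof (rule insert.IH)
    fix i' j x y assume *: "j \<in> J" "i' \<in> I - A j" "x \<in> space (PiM I M)" "y \<in> space (M i')"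
    have "g j (x(i' := y, i := z)) = g j (x(i := z))" if "z \<in> space (M i)" for z
    proof -
      have "x(i' := y, i := z) = x(i := z, i' := y)" using insert.hyps * by auto
      then show ?thesis
        using insert.prems(3)[of j i' "x(i := z)" y] * upd[OF *(3) that] by (simp del: fun_upd_apply)
    qed
    then have "(\<integral>z. exp (real d * g j (x(i' := y, i := z))) \<partial>M i) = (\<integral>z. exp (real d * g j (x(i := z))) \<partial>M i)"
      by (intro Bochner_Integration.integral_cong) auto
    then show "g' j (x(i' := y)) = g' j x" by (simp add: g'_def)
  qed (use g'_meas g'_bound insert.prems(4) in auto)
  also have "(\<Sum>j\<in>J. ln (\<integral>x. exp (real d * g' j x) \<partial>PiM I M) / real d)
      = (\<Sum>j\<in>J. ln (\<integral>x. exp (real d * g j x) \<partial>PiM (insert i I) M) / real d)"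
  proof (rule sum.cong[OF refl])
    fix j assume j: "j \<in> J"
    have "integrable (PiM (insert i I) M) (\<lambda>x. exp (real d * g j x))"
      by (rule PiI.integrable_exp_bounded[of _ "real d * B"]) (use j cbound in auto)
    then have "(\<integral>x. exp (real d * g j x) \<partial>PiM (insert i I) M)
        = (\<integral>x. (\<integral>y. exp (real d * g j (x(i := y))) \<partial>M i) \<partial>PiM I M)"
      by (rule product_integral_insert[OF insert.hyps])
    also have "\<dots> = (\<integral>x. exp (real d * g' j x) \<partial>PiM I M)"
      using fibre[OF j] by (intro Bochner_Integration.integral_cong) auto
    finally show "ln (\<integral>x. exp (real d * g' j x) \<partial>PiM I M) / real d
        = ln (\<integral>x. exp (real d * g j x) \<partial>PiM (insert i I) M) / real d" by simp
  qed
  finally show ?case .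
qed

section \<open>Deleting a vertex and the injective density\<close>

text \<open>
  Truncation does not change weights that are in \<open>[0, 1]\<close>, and it makes the densities bounded
  everywhere, as the pointwise hypotheses of \<open>ln_integral_exp_sum_le\<close> demand.
\<close>
definition trunc_weight :: "nat \<Rightarrow> (nat \<times> nat \<Rightarrow> real) \<Rightarrow> nat \<Rightarrow> nat \<Rightarrow> real" where
  "trunc_weight n g i j = max 0 (min 1 (edge_weight n g i j))"

definition injections :: "nat \<Rightarrow> nat \<Rightarrow> (nat \<Rightarrow> nat) set" where
  "injections k n = {\<phi> \<in> {1..k} \<rightarrow>\<^sub>E {1..n}. inj_on \<phi> {1..k}}"

definition inj_density :: "nat \<Rightarrow> (nat \<times> nat) set \<Rightarrow> nat \<Rightarrow> (nat \<times> nat \<Rightarrow> real) \<Rightarrow> real" where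
  "inj_density k E n g =
     (\<Sum>\<phi>\<in>injections k n. \<Prod>(i, j)\<in>E. trunc_weight n g (\<phi> i) (\<phi> j)) / real (card (injections k n))"

text \<open>The order-preserving enumeration of the positive integers other than \<open>v\<close>.\<close>
definition skip :: "nat \<Rightarrow> nat \<Rightarrow> nat" where
  "skip v i = (if i < v then i else Suc i)"

text \<open>
  The remaining vertices are renumbered, so that the result is again a point of the space of graphs
  on \<open>{1..n}\<close>. As \<open>skip v\<close> is increasing, it maps pairs \<open>(i, j)\<close> with \<open>i < j\<close> to such pairs.
\<close>
definition delete_vertex :: "nat \<Rightarrow> nat \<Rightarrow> (nat \<times> nat \<Rightarrow> real) \<Rightarrow> nat \<times> nat \<Rightarrow> real" where
  "delete_vertex n v g = (\<lambda>e\<in>vertex_pairs n. g (map_prod (skip v) (skip v) e))"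

lemma finite_vertex_pairs: "finite (vertex_pairs n)"
  and card_vertex_pairs_le: "card (vertex_pairs n) \<le> n * (n - 1)"
proof -
  have sub: "vertex_pairs n \<subseteq> {1..n} \<times> {1..n} - (\<lambda>i. (i, i)) ` {1..n}"
    by (auto simp: vertex_pairs_def)
  then show "finite (vertex_pairs n)" by (rule finite_subset) auto
  have "card (vertex_pairs n) \<le> card ({1..n} \<times> {1..n} - (\<lambda>i. (i, i)) ` {1..n})"
    by (rule card_mono[OF _ sub]) auto
  also have "\<dots> = n * n - n"
    by (subst card_Diff_subset) (auto simp: card_cartesian_product card_image inj_on_def)
  finally show "card (vertex_pairs n) \<le> n * (n - 1)" by (simp add: algebra_simps)
qed

lemma finite_edges: "simple_graph k E \<Longrightarrow> finite E"
  using finite_subset finite_vertex_pairs by (auto simp: simple_graph_def)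

lemma edge_in_range: "simple_graph k E \<Longrightarrow> (i, j) \<in> E \<Longrightarrow> i \<in> {1..k} \<and> j \<in> {1..k} \<and> i < j"
  by (auto simp: simple_graph_def vertex_pairs_def)

lemma skip_neq: "skip v i \<noteq> v"
  by (auto simp: skip_def)

lemma strict_mono_skip: "strict_mono (skip v)"
  by (auto simp: strict_mono_def skip_def)

lemma skip_image: "v \<in> {1..Suc n} \<Longrightarrow> skip v ` {1..n} = {1..Suc n} - {v}"
proof (intro equalityI subsetI)
  fix x assume v: "v \<in> {1..Suc n}" and x: "x \<in> {1..Suc n} - {v}"
  show "x \<in> skip v ` {1..n}"
  proof (cases "x < v")
    case True then show ?thesis using v x by (intro image_eqI[of _ _ x]) (auto simp: skip_def)
  next
    case False then show ?thesis using v x by (intro image_eqI[of _ _ "x - 1"]) (auto simp: skip_def)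
  qed
qed (auto simp: skip_def split: if_splits)

lemma skip_pair_in_vertex_pairs:
  "v \<in> {1..Suc n} \<Longrightarrow> i \<in> {1..n} \<Longrightarrow> j \<in> {1..n}
    \<Longrightarrow> (skip v i, skip v j) \<in> vertex_pairs (Suc n) \<longleftrightarrow> (i, j) \<in> vertex_pairs n"
  by (auto simp: vertex_pairs_def skip_def split: if_splits)

lemma trunc_weight_delete_vertex:
  assumes "v \<in> {1..Suc n}" "i \<in> {1..n}" "j \<in> {1..n}"
  shows "trunc_weight n (delete_vertex n v g) i j = trunc_weight (Suc n) g (skip v i) (skip v j)"
  using assms by (simp add: trunc_weight_def edge_weight_def skip_pair_in_vertex_pairs delete_vertex_def)

lemma finite_injections: "finite (injections k n)"
  by (rule finite_subset[of _ "{1..k} \<rightarrow>\<^sub>E {1..n}"]) (auto simp: injections_def intro!: finite_PiE)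

lemma card_injections: "card (injections k n) = (\<Prod>i<k. n - i)"
  using card_inj_on_subset_funcset[of "{1..k}" "{1..n}" "{1..k}"]
  by (simp add: injections_def atLeast0LessThan)

lemma card_injections_pos: "k \<le> n \<Longrightarrow> card (injections k n) > 0"
  by (simp add: card_injections prod_pos)

lemma bij_betw_skip_injections:
  assumes "v \<in> {1..Suc n}"
  shows "bij_betw (\<lambda>\<phi>. \<lambda>i\<in>{1..k}. skip v (\<phi> i)) (injections k n)
           {\<psi> \<in> injections k (Suc n). v \<notin> \<psi> ` {1..k}}"
proof (rule bij_betwI[where g = "\<lambda>\<psi>. \<lambda>i\<in>{1..k}. the_inv_into {1..n} (skip v) (\<psi> i)"])
  have inj: "inj_on (skip v) S" for S
    using strict_mono_skip strict_mono_imp_inj_on inj_on_subset by blast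
  note img = skip_image[OF assms]
  show "(\<lambda>\<phi>. \<lambda>i\<in>{1..k}. skip v (\<phi> i)) \<in> injections k n \<rightarrow> {\<psi> \<in> injections k (Suc n). v \<notin> \<psi> ` {1..k}}"
  proof
    fix \<phi> assume \<phi>: "\<phi> \<in> injections k n"
    have "skip v (\<phi> i) \<in> {1..Suc n} - {v}" if "i \<in> {1..k}" for i
      using \<phi> that img by (fastforce simp: injections_def PiE_iff)
    moreover have "inj_on (\<lambda>i\<in>{1..k}. skip v (\<phi> i)) {1..k}"
      unfolding inj_on_restrict_eq
      using comp_inj_on[of \<phi> "{1..k}" "skip v"] \<phi> inj by (simp add: injections_def comp_def)
    ultimately show "(\<lambda>i\<in>{1..k}. skip v (\<phi> i)) \<in> {\<psi> \<in> injections k (Suc n). v \<notin> \<psi> ` {1..k}}"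
      by (auto simp: injections_def skip_neq skip_neq[THEN not_sym])
  qed
  show "(\<lambda>\<psi>. \<lambda>i\<in>{1..k}. the_inv_into {1..n} (skip v) (\<psi> i))
      \<in> {\<psi> \<in> injections k (Suc n). v \<notin> \<psi> ` {1..k}} \<rightarrow> injections k n"
  proof
    fix \<psi> assume \<psi>: "\<psi> \<in> {\<psi> \<in> injections k (Suc n). v \<notin> \<psi> ` {1..k}}"
    have \<psi>img: "\<psi> i \<in> skip v ` {1..n}" if "i \<in> {1..k}" for i
      using \<psi> that unfolding img by (auto simp: injections_def PiE_iff)
    have "inj_on (\<lambda>i\<in>{1..k}. the_inv_into {1..n} (skip v) (\<psi> i)) {1..k}"
    proof (rule inj_onI)
      fix i j assume ij: "i \<in> {1..k}" "j \<in> {1..k}"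
        and "(\<lambda>i\<in>{1..k}. the_inv_into {1..n} (skip v) (\<psi> i)) i = (\<lambda>i\<in>{1..k}. the_inv_into {1..n} (skip v) (\<psi> i)) j"
      then have "the_inv_into {1..n} (skip v) (\<psi> i) = the_inv_into {1..n} (skip v) (\<psi> j)" by simp
      then have "\<psi> i = \<psi> j"
        using f_the_inv_into_f[OF inj \<psi>img] ij by metis
      then show "i = j" using \<psi> ij by (auto simp: injections_def dest: inj_onD)
    qed
    moreover have "the_inv_into {1..n} (skip v) (\<psi> i) \<in> {1..n}" if "i \<in> {1..k}" for i
      using the_inv_into_into[OF inj \<psi>img[OF that] order_refl] .
    ultimately show "(\<lambda>i\<in>{1..k}. the_inv_into {1..n} (skip v) (\<psi> i)) \<in> injections k n"
      by (auto simp: injections_def)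
  qed
  show "(\<lambda>i\<in>{1..k}. the_inv_into {1..n} (skip v) ((\<lambda>i\<in>{1..k}. skip v (\<phi> i)) i)) = \<phi>"
    if "\<phi> \<in> injections k n" for \<phi>
  proof
    fix i show "(\<lambda>i\<in>{1..k}. the_inv_into {1..n} (skip v) ((\<lambda>i\<in>{1..k}. skip v (\<phi> i)) i)) i = \<phi> i"
      using that the_inv_into_f_f[OF inj[of "{1..n}"], of "\<phi> i"]
      by (cases "i \<in> {1..k}") (auto simp: injections_def PiE_iff extensional_def)
  qed
  show "(\<lambda>i\<in>{1..k}. skip v ((\<lambda>i\<in>{1..k}. the_inv_into {1..n} (skip v) (\<psi> i)) i)) = \<psi>"
    if \<psi>: "\<psi> \<in> {\<psi> \<in> injections k (Suc n). v \<notin> \<psi> ` {1..k}}" for \<psi>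
  proof
    fix i show "(\<lambda>i\<in>{1..k}. skip v ((\<lambda>i\<in>{1..k}. the_inv_into {1..n} (skip v) (\<psi> i)) i)) i = \<psi> i"
    proof (cases "i \<in> {1..k}")
      case True
      then have "\<psi> i \<in> skip v ` {1..n}"
        using \<psi> unfolding img by (auto simp: injections_def PiE_iff)
      with True show ?thesis using f_the_inv_into_f[OF inj] by simp
    next
      case False then show ?thesis using \<psi> by (auto simp: injections_def PiE_iff extensional_def)
    qed
  qed
qed

text \<open>
  Double counting: an injection into \<open>{1..n + 1}\<close> misses exactly \<open>n + 1 - k\<close> vertices, and it
  arises once from each vertex \<open>v\<close> that it misses.
\<close>
lemma sum_skip_injections:
  fixes w :: "(nat \<Rightarrow> nat) \<Rightarrow> real"
  assumes "k \<le> Suc n"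
  shows "(\<Sum>v\<in>{1..Suc n}. \<Sum>\<phi>\<in>injections k n. w (\<lambda>i\<in>{1..k}. skip v (\<phi> i)))
       = real (Suc n - k) * (\<Sum>\<psi>\<in>injections k (Suc n). w \<psi>)"
proof -
  have "(\<Sum>v\<in>{1..Suc n}. \<Sum>\<phi>\<in>injections k n. w (\<lambda>i\<in>{1..k}. skip v (\<phi> i)))
      = (\<Sum>v\<in>{1..Suc n}. \<Sum>\<psi>\<in>{\<psi> \<in> injections k (Suc n). v \<notin> \<psi> ` {1..k}}. w \<psi>)"
    by (intro sum.cong refl sum.reindex_bij_betw[OF bij_betw_skip_injections])
  also have "\<dots> = (\<Sum>\<psi>\<in>injections k (Suc n). \<Sum>v\<in>{v\<in>{1..Suc n}. v \<notin> \<psi> ` {1..k}}. w \<psi>)"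
    by (rule sum.swap_restrict) (auto simp: finite_injections)
  also have "\<dots> = (\<Sum>\<psi>\<in>injections k (Suc n). real (Suc n - k) * w \<psi>)"
  proof (rule sum.cong[OF refl])
    fix \<psi> assume \<psi>: "\<psi> \<in> injections k (Suc n)"
    have "{v\<in>{1..Suc n}. v \<notin> \<psi> ` {1..k}} = {1..Suc n} - \<psi> ` {1..k}" by auto
    moreover have "card ({1..Suc n} - \<psi> ` {1..k}) = Suc n - k"
      using \<psi> by (subst card_Diff_subset) (auto simp: injections_def PiE_iff card_image)
    ultimately show "(\<Sum>v\<in>{v\<in>{1..Suc n}. v \<notin> \<psi> ` {1..k}}. w \<psi>) = real (Suc n - k) * w \<psi>"
      by (simp add: of_nat_diff)
  qed
  finally show ?thesis by (simp add: sum_distrib_left)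
qed

text \<open>
  Restricting to injections makes the averaging exact; with all maps \<open>{1..k} \<rightarrow> {1..n}\<close> the
  identity would hold only up to an error.
\<close>
lemma inj_density_Suc:
  assumes E: "simple_graph k E" and kn: "k \<le> n"
  shows "inj_density k E (Suc n) g = (\<Sum>v\<in>{1..Suc n}. inj_density k E n (delete_vertex n v g)) / real (Suc n)"
proof -
  define w where "w \<phi> = (\<Prod>(i, j)\<in>E. trunc_weight (Suc n) g (\<phi> i) (\<phi> j))" for \<phi>
  have card: "real (Suc n - k) * real (card (injections k (Suc n))) = real (Suc n) * real (card (injections k n))"
    using sum_skip_injections[of k n "\<lambda>_. 1"] kn by (simp add: mult.commute)
  have w: "(\<Prod>(i, j)\<in>E. trunc_weight n (delete_vertex n v g) (\<phi> i) (\<phi> j)) = w (\<lambda>i\<in>{1..k}. skip v (\<phi> i))"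
    if "v \<in> {1..Suc n}" "\<phi> \<in> injections k n" for v \<phi>
    unfolding w_def
  proof (rule prod.cong[OF refl], clarify)
    fix i j assume ij: "(i, j) \<in> E"
    have "\<phi> i \<in> {1..n}" "\<phi> j \<in> {1..n}"
      using that edge_in_range[OF E ij] by (auto simp: injections_def PiE_iff)
    then show "trunc_weight n (delete_vertex n v g) (\<phi> i) (\<phi> j)
      = trunc_weight (Suc n) g ((\<lambda>i\<in>{1..k}. skip v (\<phi> i)) i) ((\<lambda>i\<in>{1..k}. skip v (\<phi> i)) j)"
      using edge_in_range[OF E ij] that by (simp add: trunc_weight_delete_vertex)
  qed
  have "(\<Sum>v\<in>{1..Suc n}. inj_density k E n (delete_vertex n v g))
      = (\<Sum>v\<in>{1..Suc n}. (\<Sum>\<phi>\<in>injections k n. w (\<lambda>i\<in>{1..k}. skip v (\<phi> i))) / real (card (injections k n)))"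
    unfolding inj_density_def using w by (intro sum.cong arg_cong2[of _ _ _ _ "(/)"]) auto
  also have "\<dots> = real (Suc n - k) * (\<Sum>\<psi>\<in>injections k (Suc n). w \<psi>) / real (card (injections k n))"
    using sum_skip_injections[of k n w] kn by (simp flip: sum_divide_distrib)
  also have "\<dots> = real (Suc n) * inj_density k E (Suc n) g"
  proof -
    have "real (Suc n - k) = real (Suc n) * real (card (injections k n)) / real (card (injections k (Suc n)))"
      using card card_injections_pos[of k "Suc n"] kn by (simp only: eq_divide_eq) simp
    then show ?thesis
      using card_injections_pos[OF kn] by (simp only: inj_density_def w_def[symmetric]) simp
  qed
  finally show ?thesis by simp
qed

lemma trunc_weight_bounds: "0 \<le> trunc_weight n g i j" "trunc_weight n g i j \<le> 1"
  by (auto simp: trunc_weight_def)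

lemma inj_density_bounds: "0 \<le> inj_density k E n g" "inj_density k E n g \<le> 1"
proof -
  have w: "0 \<le> (\<Prod>(i, j)\<in>E. trunc_weight n g (\<phi> i) (\<phi> j))"
    "(\<Prod>(i, j)\<in>E. trunc_weight n g (\<phi> i) (\<phi> j)) \<le> 1" for \<phi>
    by (auto intro!: prod_nonneg prod_le_1 simp: trunc_weight_bounds)
  show "0 \<le> inj_density k E n g"
    using w by (simp add: inj_density_def sum_nonneg)
  have "(\<Sum>\<phi>\<in>injections k n. \<Prod>(i, j)\<in>E. trunc_weight n g (\<phi> i) (\<phi> j)) \<le> real (card (injections k n)) * 1"
    using sum_bounded_above[OF w(2)] by simp
  then show "inj_density k E n g \<le> 1"
    by (auto simp: inj_density_def divide_le_eq_1)
qed

lemma delete_vertex_update: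
  "v = i \<or> v = j \<Longrightarrow> delete_vertex n v (g((i, j) := y)) = delete_vertex n v g"
  using skip_neq[of v] by (fastforce simp: delete_vertex_def fun_eq_iff)

lemma simple_graph_edge: "simple_graph 2 {(1, 2)}"
  by (auto simp: simple_graph_def vertex_pairs_def)

section \<open>Homomorphism densities as finite averages\<close>

definition injective_fraction :: "nat \<Rightarrow> nat \<Rightarrow> real" where
  "injective_fraction k n = real (card (injections k n)) / real n ^ k"

definition cell :: "nat \<Rightarrow> real \<Rightarrow> nat" where
  "cell n x = nat \<lceil>real n * x\<rceil>"

abbreviation unit_uniform :: "real measure" where
  "unit_uniform \<equiv> restrict_space lborel {0..1}"

lemma prob_space_unit_uniform: "prob_space unit_uniform"
  by (rule prob_space_restrict_space) simp_all

lemma measurable_cell [measurable]: "cell n \<in> unit_uniform \<rightarrow>\<^sub>M count_space UNIV"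
  unfolding cell_def by (rule measurable_restrict_space1) measurable

lemma cell_le: "x \<in> {0..1} \<Longrightarrow> cell n x \<le> n"
  unfolding cell_def by (simp add: nat_le_iff ceiling_le_iff mult_left_le)

text \<open>
  On the unit interval the value 0 occurs only at \<open>x = 0\<close>, where the ceiling function names no vertex.
\<close>
lemma integral_cell:
  assumes "a \<le> n" "n > 0"
  shows "(\<integral>x. of_bool (cell n x = a) \<partial>unit_uniform) = (if a = 0 then 0 else 1 / real n)"
proof -
  define T where "T = (if a = 0 then {0} else {(real a - 1) / n <.. real a / n})"
  have "(\<integral>x. of_bool (cell n x = a) \<partial>unit_uniform)
      = (\<integral>x. indicator {0..1} x *\<^sub>R of_bool (cell n x = a) \<partial>lborel :: real)"
    by (rule integral_restrict_space) simp
  also have "\<dots> = (\<integral>x. indicator T x \<partial>lborel)"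
  proof (rule Bochner_Integration.integral_cong[OF refl])
    fix x :: real
    have "x \<in> {0..1} \<and> cell n x = a \<longleftrightarrow> x \<in> T"
    proof (cases "a = 0")
      case True
      have "real n * x \<le> 0 \<longleftrightarrow> x \<le> 0" using assms by (simp add: mult_le_0_iff)
      then show ?thesis using True by (auto simp: cell_def ceiling_le_zero T_def)
    next
      case False
      have "cell n x = a \<longleftrightarrow> \<lceil>real n * x\<rceil> = int a"
        using False by (auto simp: cell_def)
      also have "\<dots> \<longleftrightarrow> real a - 1 < real n * x \<and> real n * x \<le> real a"
        by (simp add: ceiling_eq_iff)
      also have "\<dots> \<longleftrightarrow> x \<in> {(real a - 1) / n <.. real a / n}"
        using assms by (auto simp: field_simps)
      finally have *: "cell n x = a \<longleftrightarrow> x \<in> {(real a - 1) / n <.. real a / n}" .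
      have "x \<in> {0..1}" if "x \<in> {(real a - 1) / n <.. real a / n}"
      proof -
        have "0 \<le> (real a - 1) / n" "real a / n \<le> 1" using assms False by auto
        then show ?thesis using that by auto
      qed
      then show ?thesis using * False by (auto simp: T_def)
    qed
    then show "indicator {0..1} x *\<^sub>R of_bool (cell n x = a)
        = (indicator T x :: real)"
      by (auto simp: indicator_def)
  qed
  also have "\<dots> = (if a = 0 then 0 else 1 / real n)"
    using assms by (auto simp: T_def measure_def divide_right_mono diff_divide_distrib)
  finally show ?thesis .
qed

text \<open>
  The graphon is constant on the cells of the grid of mesh \<open>1 / n\<close>, so the integrand is a linear
  combination of indicators of products of cells, whose integrals factorize.
\<close>
lemma hom_density_eq_sum:
  assumes E: "simple_graph k E" and n: "n > 0"
  shows "hom_density k E n g =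
    (\<Sum>\<phi>\<in>{1..k} \<rightarrow>\<^sub>E {1..n}. \<Prod>(i, j)\<in>E. edge_weight n g (\<phi> i) (\<phi> j)) / real n ^ k"
proof -
  interpret product_prob_space "\<lambda>_::nat. unit_uniform"
    by (rule product_prob_spaceI[OF prob_space_unit_uniform])
  define F where "F \<phi> = (\<Prod>(i, j)\<in>E. edge_weight n g (\<phi> i) (\<phi> j))" for \<phi>
  have fin: "finite ({1..k} \<rightarrow>\<^sub>E {0..n})" by (intro finite_PiE) auto
  have point: "(\<Prod>(i, j)\<in>E. graphon n g (x i) (x j))
      = (\<Sum>\<phi>\<in>{1..k} \<rightarrow>\<^sub>E {0..n}. F \<phi> * (\<Prod>i\<in>{1..k}. of_bool (cell n (x i) = \<phi> i)))"
    if x: "x \<in> space (PiM {1..k} (\<lambda>_. unit_uniform))" for x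
  proof -
    define \<phi>0 where "\<phi>0 = (\<lambda>i\<in>{1..k}. cell n (x i))"
    have mem: "\<phi>0 \<in> {1..k} \<rightarrow>\<^sub>E {0..n}"
      using x cell_le by (auto simp: \<phi>0_def space_PiM PiE_iff space_restrict_space)
    have "(\<Prod>i\<in>{1..k}. of_bool (cell n (x i) = \<phi> i)) = (of_bool (\<phi> = \<phi>0) :: real)"
      if "\<phi> \<in> {1..k} \<rightarrow>\<^sub>E {0..n}" for \<phi>
    proof (cases "\<phi> = \<phi>0")
      case False
      then have "\<exists>i\<in>{1..k}. \<phi> i \<noteq> \<phi>0 i"
        using PiE_ext[OF that mem] by blast
      then have "\<exists>i\<in>{1..k}. cell n (x i) \<noteq> \<phi> i"
        unfolding \<phi>0_def by (metis restrict_apply')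
      then show ?thesis using False by (subst prod_zero) auto
    qed (simp add: \<phi>0_def)
    then have "(\<Sum>\<phi>\<in>{1..k} \<rightarrow>\<^sub>E {0..n}. F \<phi> * (\<Prod>i\<in>{1..k}. of_bool (cell n (x i) = \<phi> i)))
        = (\<Sum>\<phi>\<in>{1..k} \<rightarrow>\<^sub>E {0..n}. if \<phi> = \<phi>0 then F \<phi> else 0)"
      by (intro sum.cong) auto
    also have "\<dots> = F \<phi>0" using mem fin by simp
    also have "\<dots> = (\<Prod>(i, j)\<in>E. graphon n g (x i) (x j))"
      unfolding F_def by (rule prod.cong)
        (auto simp: \<phi>0_def graphon_def cell_def dest: edge_in_range[OF E])
    finally show ?thesis by simp
  qed
  have int: "integrable unit_uniform (\<lambda>x. of_bool (cell n x = a) :: real)" for a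
    using prob_space_unit_uniform
    by (intro finite_measure.integrable_const_bound[of _ _ 1]) (auto simp: prob_space_def)
  have "hom_density k E n g = (\<integral>x. (\<Sum>\<phi>\<in>{1..k} \<rightarrow>\<^sub>E {0..n}.
      F \<phi> * (\<Prod>i\<in>{1..k}. of_bool (cell n (x i) = \<phi> i))) \<partial>PiM {1..k} (\<lambda>_. unit_uniform))"
    unfolding hom_density_def by (rule Bochner_Integration.integral_cong[OF refl point])
  also have "\<dots> = (\<Sum>\<phi>\<in>{1..k} \<rightarrow>\<^sub>E {0..n}.
      F \<phi> * (\<integral>x. (\<Prod>i\<in>{1..k}. of_bool (cell n (x i) = \<phi> i)) \<partial>PiM {1..k} (\<lambda>_. unit_uniform)))"
    using product_integrable_prod[of "{1..k}" "\<lambda>i x. of_bool (cell n x = \<phi> i) :: real" for \<phi>] int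
    by (subst Bochner_Integration.integral_sum) auto
  also have "\<dots> = (\<Sum>\<phi>\<in>{1..k} \<rightarrow>\<^sub>E {0..n}. F \<phi> * (\<Prod>i\<in>{1..k}. if \<phi> i = 0 then 0 else 1 / real n))"
  proof (rule sum.cong[OF refl])
    fix \<phi> assume \<phi>: "\<phi> \<in> {1..k} \<rightarrow>\<^sub>E {0..n}"
    have "(\<integral>x. (\<Prod>i\<in>{1..k}. of_bool (cell n (x i) = \<phi> i)) \<partial>PiM {1..k} (\<lambda>_. unit_uniform))
      = (\<Prod>i\<in>{1..k}. \<integral>x. of_bool (cell n x = \<phi> i) \<partial>unit_uniform :: real)"
      by (rule product_integral_prod) (use int in auto)
    also have "\<dots> = (\<Prod>i\<in>{1..k}. if \<phi> i = 0 then 0 else 1 / real n)"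
      using \<phi> n by (intro prod.cong refl integral_cell) (auto simp: PiE_iff)
    finally show "F \<phi> * (\<integral>x. (\<Prod>i\<in>{1..k}. of_bool (cell n (x i) = \<phi> i)) \<partial>PiM {1..k} (\<lambda>_. unit_uniform))
      = F \<phi> * (\<Prod>i\<in>{1..k}. if \<phi> i = 0 then 0 else 1 / real n)" by simp
  qed
  also have "\<dots> = (\<Sum>\<phi>\<in>{1..k} \<rightarrow>\<^sub>E {1..n}. F \<phi> * (\<Prod>i\<in>{1..k}. if \<phi> i = 0 then 0 else 1 / real n))"
  proof (rule sum.mono_neutral_right[OF fin])
    show "{1..k} \<rightarrow>\<^sub>E {1..n} \<subseteq> {1..k} \<rightarrow>\<^sub>E {0..n}" by (rule PiE_mono) auto
    show "\<forall>\<phi>\<in>({1..k} \<rightarrow>\<^sub>E {0..n}) - ({1..k} \<rightarrow>\<^sub>E {1..n}).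
        F \<phi> * (\<Prod>i\<in>{1..k}. if \<phi> i = 0 then 0 else 1 / real n) = 0"
    proof
      fix \<phi> assume \<phi>: "\<phi> \<in> ({1..k} \<rightarrow>\<^sub>E {0..n}) - ({1..k} \<rightarrow>\<^sub>E {1..n})"
      have "\<exists>i\<in>{1..k}. \<phi> i = 0"
      proof (rule ccontr)
        assume nz: "\<not> (\<exists>i\<in>{1..k}. \<phi> i = 0)"
        have \<phi>n: "\<phi> \<in> {1..k} \<rightarrow>\<^sub>E {0..n}" using \<phi> by blast
        have "\<phi> i \<in> {1..n}" if "i \<in> {1..k}" for i
        proof -
          have "\<phi> i \<noteq> 0" using nz that by metis
          moreover have "\<phi> i \<in> {0..n}" using PiE_mem[OF \<phi>n that] .
          ultimately show ?thesis by simp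
        qed
        then have "\<phi> \<in> {1..k} \<rightarrow>\<^sub>E {1..n}" using \<phi>n unfolding PiE_iff by blast
        then show False using \<phi> by blast
      qed
      then have "\<exists>i\<in>{1..k}. (if \<phi> i = 0 then 0 else 1 / real n) = 0" by metis
      then have "(\<Prod>i\<in>{1..k}. if \<phi> i = 0 then 0 else 1 / real n) = 0"
        by (rule prod_zero[rotated]) simp
      then show "F \<phi> * (\<Prod>i\<in>{1..k}. if \<phi> i = 0 then 0 else 1 / real n) = 0" by simp
    qed
  qed
  also have "\<dots> = (\<Sum>\<phi>\<in>{1..k} \<rightarrow>\<^sub>E {1..n}. F \<phi> / real n ^ k)"
  proof (rule sum.cong[OF refl])
    fix \<phi> assume \<phi>: "\<phi> \<in> {1..k} \<rightarrow>\<^sub>E {1..n}"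
    have "\<phi> i \<noteq> 0" if "i \<in> {1..k}" for i
      using PiE_mem[OF \<phi> that] by simp
    then have "(\<Prod>i\<in>{1..k}. if \<phi> i = 0 then 0 else 1 / real n) = (\<Prod>i\<in>{1..k}. 1 / real n)"
      by (intro prod.cong refl if_not_P)
    then show "F \<phi> * (\<Prod>i\<in>{1..k}. if \<phi> i = 0 then 0 else 1 / real n) = F \<phi> / real n ^ k"
      by (simp add: power_divide)
  qed
  finally show ?thesis by (simp add: F_def sum_divide_distrib)
qed

lemma edge_weight_bounds:
  assumes "\<And>e. e \<in> vertex_pairs n \<Longrightarrow> g e \<in> {0..1}"
  shows "0 \<le> edge_weight n g i j" "edge_weight n g i j \<le> 1"
  using assms by (force simp: edge_weight_def)+

text \<open>
  Two errors of the same size: the maps that are not injective contribute at most their proportion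
  \<open>1 - injective_fraction k n\<close>, and so does the change of the normalization from \<open>n ^ k\<close> to the
  number of injections.
\<close>
lemma hom_density_diff_inj_density:
  assumes E: "simple_graph k E" and n: "n > 0" and kn: "k \<le> n"
    and g: "\<And>e. e \<in> vertex_pairs n \<Longrightarrow> g e \<in> {0..1}"
  shows "\<bar>hom_density k E n g - inj_density k E n g\<bar> \<le> 2 * (1 - injective_fraction k n)"
proof -
  define w where "w \<phi> = (\<Prod>(i, j)\<in>E. edge_weight n g (\<phi> i) (\<phi> j))" for \<phi>
  have w: "0 \<le> w \<phi>" "w \<phi> \<le> 1" for \<phi>
    unfolding w_def using edge_weight_bounds[OF g]
    by (auto intro!: prod_nonneg prod_le_1)
  let ?A = "{1..k} \<rightarrow>\<^sub>E {1..n}" and ?I = "injections k n"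
  have fin: "finite ?A" by (intro finite_PiE) auto
  have sub: "?I \<subseteq> ?A" by (auto simp: injections_def)
  have cA: "real (card ?A) = real n ^ k" by (simp add: card_funcsetE)
  define N where "N = real n ^ k"
  \<comment> \<open>\<open>N\<close> counts all maps and \<open>c\<close> the injective ones; \<open>S\<close> is the weight of the injective maps and \<open>R\<close> that of the others.\<close>
  define c where "c = real (card ?I)"
  define S where "S = sum w ?I"
  define R where "R = sum w (?A - ?I)"
  have N: "N > 0" using n by (simp add: N_def)
  have c: "c > 0" using card_injections_pos[OF kn] by (simp add: c_def)
  have cN: "c \<le> N" unfolding c_def N_def cA[symmetric] using card_mono[OF fin sub] by simp
  have S: "0 \<le> S" "S \<le> c"
    unfolding S_def c_def using w sum_bounded_above[of ?I w 1] by (auto intro: sum_nonneg)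
  have R: "0 \<le> R" "R \<le> N - c"
    unfolding R_def using w sum_bounded_above[of "?A - ?I" w 1] card_Diff_subset[OF finite_injections sub]
      card_mono[OF fin sub]
    by (auto intro: sum_nonneg simp: N_def cA[symmetric] c_def of_nat_diff)
  have hom: "hom_density k E n g = (R + S) / N"
    using hom_density_eq_sum[OF E n, of g] sum.subset_diff[OF sub fin, of w]
    by (simp add: w_def[symmetric] N_def R_def S_def)
  have inj: "inj_density k E n g = S / c"
  proof -
    have "trunc_weight n g i j = edge_weight n g i j" for i j
      using edge_weight_bounds[of n g i j, OF g] by (simp add: trunc_weight_def)
    then show ?thesis by (simp add: inj_density_def S_def c_def w_def)
  qed
  have 1: "0 \<le> R / N" "R / N \<le> 1 - c / N"
    using R N by (auto simp: field_simps)
  have 2: "0 \<le> S / c - S / N" "S / c - S / N \<le> 1 - c / N"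
  proof -
    have "S / c - S / N = (S / c) * (1 - c / N)" using c N by (simp add: field_simps)
    moreover have "0 \<le> S / c" "S / c \<le> 1" "0 \<le> 1 - c / N" using S c cN N by auto
    ultimately show "0 \<le> S / c - S / N" "S / c - S / N \<le> 1 - c / N"
      using mult_right_mono[of "S / c" 1 "1 - c / N"] mult_nonneg_nonneg[of "S / c" "1 - c / N"]
      by auto
  qed
  have "hom_density k E n g - inj_density k E n g = R / N - (S / c - S / N)"
    by (simp add: hom inj add_divide_distrib)
  then show ?thesis
    using 1 2 by (simp add: injective_fraction_def N_def c_def)
qed

lemma injective_fraction_tendsto: "injective_fraction k \<longlonglongrightarrow> 1"
proof -
  have "(\<lambda>n. \<Prod>i<k. 1 - real i / real n) \<longlonglongrightarrow> (\<Prod>i<k. 1 - 0)"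
    by (intro tendsto_prod tendsto_diff tendsto_const lim_const_over_n)
  moreover have "\<forall>\<^sub>F n in sequentially. (\<Prod>i<k. 1 - real i / real n) = injective_fraction k n"
    using eventually_gt_at_top[of k]
  proof eventually_elim
    case (elim n)
    have "injective_fraction k n = (\<Prod>i<k. real (n - i) / real n)"
      by (simp add: injective_fraction_def card_injections prod_dividef)
    also have "\<dots> = (\<Prod>i<k. 1 - real i / real n)"
      using elim by (intro prod.cong) (auto simp: of_nat_diff diff_divide_distrib)
    finally show ?case by simp
  qed
  ultimately show ?thesis using Lim_transform_eventually by fastforce
qed

text \<open>
  Drop all edges but one: the other factors are at most 1. The density of a single edge \<open>(a, b)\<close>
  does not depend on the number of vertices, as the law of \<open>(x\<^sub>a, x\<^sub>b)\<close> is the law of \<open>(x\<^sub>1, x\<^sub>2)\<close>.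
\<close>
lemma hom_density_le_edge_density:
  assumes E: "simple_graph k E" and "E \<noteq> {}"
    and g: "\<And>e. e \<in> vertex_pairs n \<Longrightarrow> g e \<in> {0..1}"
  shows "hom_density k E n g \<le> hom_density 2 {(1, 2)} n g"
proof -
  obtain a b where ab: "(a, b) \<in> E" using assms(2) by auto
  have abk: "a \<in> {1..k}" "b \<in> {1..k}" "a < b" using edge_in_range[OF E ab] by auto
  let ?P = "\<lambda>k::nat. PiM {1..k} (\<lambda>_. unit_uniform)"
  interpret Pk: prob_space "?P k" by (rule prob_space_PiM[OF prob_space_unit_uniform])
  have gr: "0 \<le> graphon n g x y" "graphon n g x y \<le> 1" for x y
    unfolding graphon_def using edge_weight_bounds[OF g] by auto
  have meas: "(\<lambda>x. graphon n g (x i) (x j)) \<in> borel_measurable (?P m)" if "i \<in> {1..m}" "j \<in> {1..m}" for i j m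
  proof -
    have [measurable]: "(\<lambda>x. x i) \<in> ?P m \<rightarrow>\<^sub>M unit_uniform" "(\<lambda>x. x j) \<in> ?P m \<rightarrow>\<^sub>M unit_uniform"
      using that by (auto intro: measurable_component_singleton)
    have [measurable]: "(\<lambda>p. edge_weight n g (fst p) (snd p))
        \<in> borel_measurable (count_space UNIV \<Otimes>\<^sub>M count_space UNIV)"
      by (subst pair_measure_countable) auto
    have "(\<lambda>x. (\<lambda>p. edge_weight n g (fst p) (snd p)) (cell n (x i), cell n (x j))) \<in> borel_measurable (?P m)"
      by measurable
    then show ?thesis by (simp add: graphon_def cell_def)
  qed
  have "hom_density k E n g \<le> (\<integral>x. graphon n g (x a) (x b) \<partial>?P k)"
    unfolding hom_density_def
  proof (rule integral_mono)
    show "integrable (?P k) (\<lambda>x. graphon n g (x a) (x b))"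
      by (rule Pk.integrable_const_bound[of _ 1]) (use gr meas abk in auto)
    have "(\<lambda>x. \<Prod>e\<in>E. graphon n g (x (fst e)) (x (snd e))) \<in> borel_measurable (?P k)"
      using edge_in_range[OF E] by (intro borel_measurable_prod meas) auto
    then have "(\<lambda>x. \<Prod>(i, j)\<in>E. graphon n g (x i) (x j)) \<in> borel_measurable (?P k)"
      by (simp add: case_prod_beta)
    moreover have "0 \<le> (\<Prod>(i, j)\<in>E. graphon n g (x i) (x j))" "(\<Prod>(i, j)\<in>E. graphon n g (x i) (x j)) \<le> 1" for x
      using gr by (auto intro!: prod_nonneg prod_le_1)
    ultimately show "integrable (?P k) (\<lambda>x. \<Prod>(i, j)\<in>E. graphon n g (x i) (x j))"
      by (intro Pk.integrable_const_bound[of _ 1]) auto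
    fix x
    have "(\<Prod>(i, j)\<in>E. graphon n g (x i) (x j))
        = graphon n g (x a) (x b) * (\<Prod>(i, j)\<in>E - {(a, b)}. graphon n g (x i) (x j))"
      using prod.remove[OF finite_edges[OF E] ab, of "\<lambda>(i, j). graphon n g (x i) (x j)"] by simp
    also have "\<dots> \<le> graphon n g (x a) (x b)"
      using gr by (intro mult_left_le prod_le_1) auto
    finally show "(\<Prod>(i, j)\<in>E. graphon n g (x i) (x j)) \<le> graphon n g (x a) (x b)" .
  qed
  also have "\<dots> = (\<integral>x. graphon n g (x 1) (x 2) \<partial>?P 2)"
  proof -
    define f where "f m = (if m = 1 then a else b)" for m :: nat
    have f: "inj_on f {1..2}" "f \<in> {1..2} \<rightarrow> {1..k}"
      using abk by (auto simp: f_def inj_on_def)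
    have "?P 2 = distr (?P k) (?P 2) (\<lambda>x. \<lambda>m\<in>{1..2}. x (f m))"
      using distr_PiM_reindex[OF _ f, of "\<lambda>_. unit_uniform"] prob_space_unit_uniform by simp
    then have "(\<integral>x. graphon n g (x 1) (x 2) \<partial>?P 2)
        = (\<integral>x. graphon n g (x 1) (x 2) \<partial>distr (?P k) (?P 2) (\<lambda>x. \<lambda>m\<in>{1..2}. x (f m)))"
      by simp
    also have "\<dots> = (\<integral>x. graphon n g ((\<lambda>m\<in>{1..2}. x (f m)) 1) ((\<lambda>m\<in>{1..2}. x (f m)) 2) \<partial>?P k)"
    proof (rule integral_distr)
      show "(\<lambda>x. \<lambda>m\<in>{1..2}. x (f m)) \<in> ?P k \<rightarrow>\<^sub>M ?P 2"
        using f by (intro measurable_restrict measurable_component_singleton) auto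
      show "(\<lambda>x. graphon n g (x 1) (x 2)) \<in> borel_measurable (?P 2)" by (rule meas) auto
    qed
    also have "\<dots> = (\<integral>x. graphon n g (x a) (x b) \<partial>?P k)" by (simp add: f_def)
    finally show ?thesis by simp
  qed
  also have "\<dots> = hom_density 2 {(1, 2)} n g" by (simp add: hom_density_def)
  finally show ?thesis .
qed

lemma hom_density_bounds:
  assumes E: "simple_graph k E" and n: "n > 0"
    and g: "\<And>e. e \<in> vertex_pairs n \<Longrightarrow> g e \<in> {0..1}"
  shows "0 \<le> hom_density k E n g" "hom_density k E n g \<le> 1"
proof -
  define w where "w \<phi> = (\<Prod>(i, j)\<in>E. edge_weight n g (\<phi> i) (\<phi> j))" for \<phi>
  have w: "0 \<le> w \<phi>" "w \<phi> \<le> 1" for \<phi>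
    unfolding w_def using edge_weight_bounds[of n g, OF g]
    by (auto intro!: prod_nonneg prod_le_1)
  have "sum w ({1..k} \<rightarrow>\<^sub>E {1..n}) \<le> real n ^ k"
    using sum_bounded_above[of "{1..k} \<rightarrow>\<^sub>E {1..n}" w 1] w by (simp add: card_funcsetE)
  then show "0 \<le> hom_density k E n g" "hom_density k E n g \<le> 1"
    using n w by (auto simp: hom_density_eq_sum[OF E n] w_def[symmetric] sum_nonneg)
qed

section \<open>Random weighted graphs\<close>

lemma prob_space_weighted_graph_measure:
  "prob_space \<mu> \<Longrightarrow> prob_space (weighted_graph_measure \<mu> n)"
  unfolding weighted_graph_measure_def by (rule prob_space_PiM)

lemma measurable_edge_weight:
  assumes "sets \<mu> = sets borel"
  shows "(\<lambda>g. edge_weight n g i j) \<in> borel_measurable (weighted_graph_measure \<mu> n)"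
proof -
  have "(\<lambda>g. g e) \<in> borel_measurable (weighted_graph_measure \<mu> n)" if "e \<in> vertex_pairs n" for e
  proof -
    have "(\<lambda>g. g e) \<in> weighted_graph_measure \<mu> n \<rightarrow>\<^sub>M \<mu>"
      unfolding weighted_graph_measure_def by (rule measurable_component_singleton[OF that])
    also have "\<dots> = borel_measurable (weighted_graph_measure \<mu> n)"
      by (rule measurable_cong_sets[OF refl assms])
    finally show ?thesis .
  qed
  then show ?thesis
    by (cases "(i, j) \<in> vertex_pairs n"; cases "(j, i) \<in> vertex_pairs n") (simp_all add: edge_weight_def)
qed

lemma measurable_inj_density:
  assumes "sets \<mu> = sets borel"
  shows "inj_density k E n \<in> borel_measurable (weighted_graph_measure \<mu> n)"
proof -
  note measurable_edge_weight[OF assms, measurable]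
  have "(\<lambda>g. (\<Sum>\<phi>\<in>injections k n. \<Prod>e\<in>E. trunc_weight n g (\<phi> (fst e)) (\<phi> (snd e)))
      / real (card (injections k n))) \<in> borel_measurable (weighted_graph_measure \<mu> n)"
    unfolding trunc_weight_def by measurable
  then show ?thesis by (simp add: inj_density_def[abs_def] case_prod_beta)
qed

lemma measurable_hom_density:
  assumes "sets \<mu> = sets borel" "simple_graph k E" "n > 0"
  shows "hom_density k E n \<in> borel_measurable (weighted_graph_measure \<mu> n)"
proof -
  note measurable_edge_weight[OF assms(1), measurable]
  have "(\<lambda>g. (\<Sum>\<phi>\<in>{1..k} \<rightarrow>\<^sub>E {1..n}. \<Prod>e\<in>E. edge_weight n g (\<phi> (fst e)) (\<phi> (snd e))) / real n ^ k)
      \<in> borel_measurable (weighted_graph_measure \<mu> n)"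
    by measurable
  then show ?thesis using hom_density_eq_sum[OF assms(2,3)] by (simp add: case_prod_beta cong: measurable_cong)
qed

lemma AE_weights_in_unit_interval:
  assumes "prob_space \<mu>" "AE x in \<mu>. x \<in> {0..1}"
  shows "AE g in weighted_graph_measure \<mu> n. \<forall>e\<in>vertex_pairs n. g e \<in> {0..1}"
  unfolding weighted_graph_measure_def
  using assms by (intro eventually_ball_finite finite_vertex_pairs ballI AE_PiM_component) auto

section \<open>Monotonicity of the free energy\<close>

definition energy :: "nat \<Rightarrow> (nat \<times> nat) set \<Rightarrow> real \<times> real \<Rightarrow> nat \<Rightarrow> (nat \<times> nat \<Rightarrow> real) \<Rightarrow> real" where
  "energy k E \<beta> n g = fst \<beta> * inj_density 2 {(1, 2)} n g + snd \<beta> * inj_density k E n g"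

text \<open>
  The normalization by \<open>n (n - 1)\<close>, twice the number of edges, instead of \<open>n\<^sup>2\<close> is what makes the
  sequence monotone without error terms.
\<close>
definition free_energy :: "real measure \<Rightarrow> nat \<Rightarrow> (nat \<times> nat) set \<Rightarrow> real \<times> real \<Rightarrow> nat \<Rightarrow> real" where
  "free_energy \<mu> k E \<beta> n =
     ln (\<integral>g. exp (real (n * (n - 1)) * energy k E \<beta> n g) \<partial>weighted_graph_measure \<mu> n) / real (n * (n - 1))"

lemma measurable_energy:
  "sets \<mu> = sets borel \<Longrightarrow> energy k E \<beta> n \<in> borel_measurable (weighted_graph_measure \<mu> n)"
  unfolding energy_def[abs_def]
  by (intro borel_measurable_add borel_measurable_times borel_measurable_const measurable_inj_density)

lemma abs_energy_le: "\<bar>energy k E \<beta> n g\<bar> \<le> \<bar>fst \<beta>\<bar> + \<bar>snd \<beta>\<bar>"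
proof -
  have "\<bar>c * inj_density k E n g\<bar> \<le> \<bar>c\<bar>" for c k E
    using inj_density_bounds[of k E n g] by (simp add: abs_mult mult_left_le)
  then show ?thesis
    unfolding energy_def by (intro order.trans[OF abs_triangle_ineq] add_mono)
qed

lemma energy_Suc:
  assumes "simple_graph k E" "k \<le> n" "2 \<le> n"
  shows "real (Suc n) * energy k E \<beta> (Suc n) g
    = (\<Sum>v\<in>{1..Suc n}. energy k E \<beta> n (delete_vertex n v g))"
proof -
  have "real (Suc n) * energy k E \<beta> (Suc n) g
    = fst \<beta> * (real (Suc n) * inj_density 2 {(1, 2)} (Suc n) g) + snd \<beta> * (real (Suc n) * inj_density k E (Suc n) g)"
    by (simp only: energy_def) (simp only: distrib_left mult.left_commute)
  also have "\<dots> = fst \<beta> * (\<Sum>v\<in>{1..Suc n}. inj_density 2 {(1, 2)} n (delete_vertex n v g))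
      + snd \<beta> * (\<Sum>v\<in>{1..Suc n}. inj_density k E n (delete_vertex n v g))"
    by (simp only: inj_density_Suc[OF assms(1,2)] inj_density_Suc[OF simple_graph_edge assms(3)]) simp
  also have "\<dots> = (\<Sum>v\<in>{1..Suc n}. energy k E \<beta> n (delete_vertex n v g))"
    by (simp only: energy_def sum.distrib sum_distrib_left)
  finally show ?thesis .
qed

lemma skip_vertex_pairs: "e \<in> vertex_pairs n \<Longrightarrow> map_prod (skip v) (skip v) e \<in> vertex_pairs (Suc n)"
  by (auto simp: vertex_pairs_def skip_def)

lemma
  assumes "prob_space \<mu>"
  shows measurable_delete_vertex:
      "delete_vertex n v \<in> weighted_graph_measure \<mu> (Suc n) \<rightarrow>\<^sub>M weighted_graph_measure \<mu> n"
    and distr_delete_vertex: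
      "distr (weighted_graph_measure \<mu> (Suc n)) (weighted_graph_measure \<mu> n) (delete_vertex n v)
        = weighted_graph_measure \<mu> n"
proof -
  show "delete_vertex n v \<in> weighted_graph_measure \<mu> (Suc n) \<rightarrow>\<^sub>M weighted_graph_measure \<mu> n"
    unfolding weighted_graph_measure_def delete_vertex_def[abs_def]
    by (intro measurable_restrict measurable_component_singleton skip_vertex_pairs)
  have "inj (skip v)" by (rule strict_mono_imp_inj_on[OF strict_mono_skip])
  then have "inj_on (map_prod (skip v) (skip v)) (vertex_pairs n)"
    by (intro inj_on_subset[OF prod.inj_map]) auto
  then show "distr (weighted_graph_measure \<mu> (Suc n)) (weighted_graph_measure \<mu> n) (delete_vertex n v)
        = weighted_graph_measure \<mu> n"
    unfolding weighted_graph_measure_def delete_vertex_def[abs_def]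
    by (rule distr_PiM_reindex[OF assms]) (use skip_vertex_pairs in auto)
qed

text \<open>
  By \<open>energy_Suc\<close>, \<open>n (n + 1)\<close> times the energy on \<open>n + 1\<close> vertices is the sum over \<open>v\<close> of \<open>n\<close> times
  the energy of the graph without \<open>v\<close>. The edge \<open>{i, j}\<close> influences the summands with
  \<open>v \<noteq> i, j\<close>, which are \<open>n - 1\<close> in number. Finner's inequality with \<open>d = n - 1\<close> therefore produces the
  exponent \<open>n (n - 1)\<close>, which is the one in the free energy on \<open>n\<close> vertices.
\<close>
lemma free_energy_Suc_le:
  assumes \<mu>: "prob_space \<mu>" "sets \<mu> = sets borel"
    and E: "simple_graph k E" and kn: "k \<le> n" "2 \<le> n"
  shows "free_energy \<mu> k E \<beta> (Suc n) \<le> free_energy \<mu> k E \<beta> n"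
proof -
  let ?G = "weighted_graph_measure \<mu>"
  define h where "h v g = real n * energy k E \<beta> n (delete_vertex n v g)" for v g
  define B where "B = real n * (\<bar>fst \<beta>\<bar> + \<bar>snd \<beta>\<bar>)"
  define Z where "Z m = ln (\<integral>g. exp (real (m * (m - 1)) * energy k E \<beta> m g) \<partial>?G m)" for m
  note measurable_energy[OF \<mu>(2), measurable] measurable_delete_vertex[OF \<mu>(1), measurable]
  have "Z (Suc n) = ln (\<integral>g. exp (\<Sum>v\<in>{1..Suc n}. h v g) \<partial>?G (Suc n))"
  proof -
    have "real (Suc n * (Suc n - 1)) * energy k E \<beta> (Suc n) g = (\<Sum>v\<in>{1..Suc n}. h v g)" for g
    proof -
      have "real (Suc n * (Suc n - 1)) * energy k E \<beta> (Suc n) g = real n * (real (Suc n) * energy k E \<beta> (Suc n) g)"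
        by (simp add: algebra_simps)
      then show ?thesis by (simp only: energy_Suc[OF E kn] h_def sum_distrib_left)
    qed
    then show ?thesis by (simp only: Z_def)
  qed
  also have "\<dots> \<le> (\<Sum>v\<in>{1..Suc n}. ln (\<integral>g. exp (real (n - 1) * h v g) \<partial>?G (Suc n)) / real (n - 1))"
    unfolding weighted_graph_measure_def
  proof (rule ln_integral_exp_sum_le[where A = "\<lambda>v. {(i, j). v \<noteq> i \<and> v \<noteq> j}" and B = B])
    show "h v \<in> borel_measurable (PiM (vertex_pairs (Suc n)) (\<lambda>_. \<mu>))" for v
      unfolding h_def[abs_def] weighted_graph_measure_def[symmetric] by measurable
    show "\<bar>h v g\<bar> \<le> B" for v g
      unfolding h_def B_def using abs_energy_le by (simp add: abs_mult mult_left_mono)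
    show "h v (g(e := y)) = h v g" if "e \<in> vertex_pairs (Suc n) - {(i, j). v \<noteq> i \<and> v \<noteq> j}" for v g e y
      using that by (cases e) (auto simp: h_def delete_vertex_update)
    fix e assume e: "e \<in> vertex_pairs (Suc n)"
    obtain i j where ij: "e = (i, j)" by (cases e)
    have "{v \<in> {1..Suc n}. e \<in> {(i, j). v \<noteq> i \<and> v \<noteq> j}} = {1..Suc n} - {i, j}"
      by (auto simp: ij)
    also have "card \<dots> = n - 1"
      using e by (subst card_Diff_subset) (auto simp: ij vertex_pairs_def)
    finally show "card {v \<in> {1..Suc n}. e \<in> {(i, j). v \<noteq> i \<and> v \<noteq> j}} = n - 1" .
  qed (use \<mu> kn finite_vertex_pairs in auto)
  also have "\<dots> = (\<Sum>v\<in>{1..Suc n}. Z n / real (n - 1))"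
  proof (rule sum.cong[OF refl])
    fix v
    have "(\<integral>g. exp (real (n - 1) * h v g) \<partial>?G (Suc n))
      = (\<integral>g. exp (real (n * (n - 1)) * energy k E \<beta> n (delete_vertex n v g)) \<partial>?G (Suc n))"
      by (simp add: h_def mult_ac)
    also have "\<dots> = (\<integral>g. exp (real (n * (n - 1)) * energy k E \<beta> n g) \<partial>distr (?G (Suc n)) (?G n) (delete_vertex n v))"
      by (rule integral_distr[symmetric]) measurable
    finally show "ln (\<integral>g. exp (real (n - 1) * h v g) \<partial>?G (Suc n)) / real (n - 1) = Z n / real (n - 1)"
      by (simp add: Z_def distr_delete_vertex[OF \<mu>(1)])
  qed
  finally have "Z (Suc n) \<le> real (Suc n) * (Z n / real (n - 1))" by simp
  then have "Z (Suc n) / real (Suc n * (Suc n - 1)) \<le> real (Suc n) * (Z n / real (n - 1)) / real (Suc n * (Suc n - 1))"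
    by (rule divide_right_mono) simp
  also have "\<dots> = Z n / real (n * (n - 1))"
    by (simp del: of_nat_Suc mult_Suc mult_Suc_right)
  finally show ?thesis by (simp only: free_energy_def Z_def)
qed

lemma abs_free_energy_le:
  assumes \<mu>: "prob_space \<mu>" "sets \<mu> = sets borel"
  shows "\<bar>free_energy \<mu> k E \<beta> n\<bar> \<le> \<bar>fst \<beta>\<bar> + \<bar>snd \<beta>\<bar>"
proof -
  interpret prob_space "weighted_graph_measure \<mu> n" by (rule prob_space_weighted_graph_measure[OF \<mu>(1)])
  note measurable_energy[OF \<mu>(2), measurable]
  have "\<bar>ln (\<integral>g. exp (real (n * (n - 1)) * energy k E \<beta> n g) \<partial>weighted_graph_measure \<mu> n)\<bar>
      \<le> real (n * (n - 1)) * (\<bar>fst \<beta>\<bar> + \<bar>snd \<beta>\<bar>)"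
  proof (rule ln_integral_exp_abs_le)
    show "AE g in weighted_graph_measure \<mu> n. \<bar>real (n * (n - 1)) * energy k E \<beta> n g\<bar>
        \<le> real (n * (n - 1)) * (\<bar>fst \<beta>\<bar> + \<bar>snd \<beta>\<bar>)"
      using abs_energy_le by (intro AE_I2) (simp only: abs_mult abs_of_nat, intro mult_left_mono; simp)
  qed measurable
  then show ?thesis
    by (cases "n * (n - 1) = 0") (auto simp: free_energy_def divide_le_eq mult.commute simp del: of_nat_mult mult_eq_0_iff)
qed

lemma convergent_free_energy:
  assumes \<mu>: "prob_space \<mu>" "sets \<mu> = sets borel" and E: "simple_graph k E"
  shows "convergent (free_energy \<mu> k E \<beta>)"
proof -
  \<comment> \<open>Below \<open>k\<close> there are no injections, and \<open>n - 1 = 0\<close> for \<open>n = 1\<close>.\<close>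
  define N where "N = max k 2"
  have "decseq (\<lambda>m. free_energy \<mu> k E \<beta> (m + N))"
    by (rule decseq_SucI) (use free_energy_Suc_le[OF \<mu> E] in \<open>simp add: N_def\<close>)
  moreover have "- (\<bar>fst \<beta>\<bar> + \<bar>snd \<beta>\<bar>) \<le> free_energy \<mu> k E \<beta> (m + N)" for m
    using abs_free_energy_le[OF \<mu>, of k E \<beta> "m + N"] by linarith
  ultimately obtain L where "(\<lambda>m. free_energy \<mu> k E \<beta> (m + N)) \<longlonglongrightarrow> L"
    using decseq_convergent by blast
  then show ?thesis using LIMSEQ_offset convergent_def by blast
qed

section \<open>Convergence of the normalization constants\<close>

text \<open>
  The factor \<open>1 - 1/n\<close> converts the normalization \<open>n (n - 1)\<close> into \<open>n\<^sup>2\<close>. The first two error terms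
  come from counting only injective maps, the last one from replacing \<open>n\<^sup>2\<close> by \<open>n (n - 1)\<close> in the
  exponent.
\<close>
lemma psi_minus_free_energy:
  assumes \<mu>: "prob_space \<mu>" "sets \<mu> = sets borel" "AE x in \<mu>. x \<in> {0..1}"
    and E: "simple_graph k E" and n: "k \<le> n" "2 \<le> n"
  shows "\<bar>psi \<mu> k E \<beta> n - (1 - 1 / real n) * free_energy \<mu> k E \<beta> n\<bar>
    \<le> \<bar>fst \<beta>\<bar> * (2 * (1 - injective_fraction 2 n)) + \<bar>snd \<beta>\<bar> * (2 * (1 - injective_fraction k n))
      + (\<bar>fst \<beta>\<bar> + \<bar>snd \<beta>\<bar>) / real n"
    (is "_ \<le> ?\<delta>")
proof -
  let ?G = "weighted_graph_measure \<mu> n"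
  interpret prob_space ?G by (rule prob_space_weighted_graph_measure[OF \<mu>(1)])
  have n0: "n > 0" using n by simp
  define h where "h g = fst \<beta> * hom_density 2 {(1, 2)} n g + snd \<beta> * hom_density k E n g" for g
  define B where "B = \<bar>fst \<beta>\<bar> + \<bar>snd \<beta>\<bar>"
  define X where "X g = (real n)\<^sup>2 * h g" for g
  define Y where "Y g = real (n * (n - 1)) * energy k E \<beta> n g" for g
  note measurable_energy[OF \<mu>(2), measurable]
    measurable_hom_density[OF \<mu>(2) E n0, measurable]
    measurable_hom_density[OF \<mu>(2) simple_graph_edge n0, measurable]
  have meas: "X \<in> borel_measurable ?G" "Y \<in> borel_measurable ?G"
    unfolding X_def[abs_def] Y_def[abs_def] h_def by measurable
  have Y: "\<bar>Y g\<bar> \<le> real (n * (n - 1)) * B" for g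
    unfolding Y_def B_def abs_mult abs_of_nat by (intro mult_left_mono abs_energy_le) simp
  have XY: "AE g in ?G. \<bar>X g - Y g\<bar> \<le> (real n)\<^sup>2 * ?\<delta>"
    using AE_weights_in_unit_interval[OF \<mu>(1,3), of n]
  proof eventually_elim
    case (elim g)
    then have g: "\<And>e. e \<in> vertex_pairs n \<Longrightarrow> g e \<in> {0..1}" by blast
    have close: "\<bar>c * (hom_density m F n g - inj_density m F n g)\<bar> \<le> \<bar>c\<bar> * (2 * (1 - injective_fraction m n))"
      if "simple_graph m F" "m \<le> n" for c m F
      unfolding abs_mult using hom_density_diff_inj_density[OF that(1) n0 that(2) g]
      by (intro mult_left_mono) auto
    have "\<bar>h g - energy k E \<beta> n g\<bar>
      = \<bar>fst \<beta> * (hom_density 2 {(1, 2)} n g - inj_density 2 {(1, 2)} n g)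
          + snd \<beta> * (hom_density k E n g - inj_density k E n g)\<bar>"
      by (simp add: h_def energy_def algebra_simps)
    also have "\<dots> \<le> \<bar>fst \<beta>\<bar> * (2 * (1 - injective_fraction 2 n)) + \<bar>snd \<beta>\<bar> * (2 * (1 - injective_fraction k n))"
      by (intro order.trans[OF abs_triangle_ineq] add_mono close simple_graph_edge E n)
    finally have 1: "\<bar>h g - energy k E \<beta> n g\<bar> \<le> ?\<delta> - B / real n" by (simp add: B_def)
    have "\<bar>energy k E \<beta> n g / real n\<bar> \<le> B / real n"
      using abs_energy_le[of k E \<beta> n g] by (simp add: B_def divide_right_mono)
    then have 2: "\<bar>(h g - energy k E \<beta> n g) + energy k E \<beta> n g / real n\<bar> \<le> ?\<delta>" using 1 by linarith
    have eq: "X g - Y g = (real n)\<^sup>2 * ((h g - energy k E \<beta> n g) + energy k E \<beta> n g / real n)"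
      using n by (simp add: X_def Y_def of_nat_diff power2_eq_square field_simps)
    show ?case
      unfolding eq abs_mult abs_power2 by (rule mult_left_mono[OF 2]) simp
  qed
  have X: "AE g in ?G. \<bar>X g\<bar> \<le> (real n)\<^sup>2 * ?\<delta> + real (n * (n - 1)) * B"
    using XY
  proof eventually_elim
    case (elim g)
    then show ?case using Y[of g] by linarith
  qed
  have YAE: "AE g in ?G. \<bar>Y g\<bar> \<le> real (n * (n - 1)) * B" using Y by simp
  have "ln (\<integral>g. exp (X g) \<partial>?G) \<le> ln (\<integral>g. exp (Y g) \<partial>?G) + (real n)\<^sup>2 * ?\<delta>"
    by (rule ln_integral_exp_mono[OF meas(1) X meas(2) YAE]) (use XY in eventually_elim, linarith)
  moreover have "ln (\<integral>g. exp (Y g) \<partial>?G) \<le> ln (\<integral>g. exp (X g) \<partial>?G) + (real n)\<^sup>2 * ?\<delta>"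
    by (rule ln_integral_exp_mono[OF meas(2) YAE meas(1) X]) (use XY in eventually_elim, linarith)
  ultimately have "\<bar>ln (\<integral>g. exp (X g) \<partial>?G) - ln (\<integral>g. exp (Y g) \<partial>?G)\<bar> \<le> (real n)\<^sup>2 * ?\<delta>" by linarith
  then have "\<bar>ln (\<integral>g. exp (X g) \<partial>?G) - ln (\<integral>g. exp (Y g) \<partial>?G)\<bar> / (real n)\<^sup>2 \<le> ?\<delta>"
    using n0 by (simp add: divide_le_eq mult.commute)
  moreover have "psi \<mu> k E \<beta> n = ln (\<integral>g. exp (X g) \<partial>?G) / (real n)\<^sup>2"
    by (simp add: psi_def X_def h_def)
  moreover have "(1 - 1 / real n) * free_energy \<mu> k E \<beta> n = ln (\<integral>g. exp (Y g) \<partial>?G) / (real n)\<^sup>2"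
    using n unfolding free_energy_def Y_def by (simp add: of_nat_diff field_simps power2_eq_square)
  ultimately show ?thesis by (simp flip: diff_divide_distrib)
qed

lemma psi_tendsto_lim_free_energy:
  assumes \<mu>: "prob_space \<mu>" "sets \<mu> = sets borel" "AE x in \<mu>. x \<in> {0..1}" and E: "simple_graph k E"
  shows "psi \<mu> k E \<beta> \<longlonglongrightarrow> lim (free_energy \<mu> k E \<beta>)"
proof -
  let ?\<delta> = "\<lambda>n. \<bar>fst \<beta>\<bar> * (2 * (1 - injective_fraction 2 n)) + \<bar>snd \<beta>\<bar> * (2 * (1 - injective_fraction k n))
      + (\<bar>fst \<beta>\<bar> + \<bar>snd \<beta>\<bar>) / real n"
  have "?\<delta> \<longlonglongrightarrow> \<bar>fst \<beta>\<bar> * (2 * (1 - 1)) + \<bar>snd \<beta>\<bar> * (2 * (1 - 1)) + 0"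
    by (intro tendsto_add tendsto_mult tendsto_diff tendsto_const injective_fraction_tendsto lim_const_over_n)
  then have \<delta>: "?\<delta> \<longlonglongrightarrow> 0" by simp
  have "(\<lambda>n. psi \<mu> k E \<beta> n - (1 - 1 / real n) * free_energy \<mu> k E \<beta> n) \<longlonglongrightarrow> 0"
  proof (rule Lim_null_comparison[OF _ \<delta>])
    show "\<forall>\<^sub>F n in sequentially. norm (psi \<mu> k E \<beta> n - (1 - 1 / real n) * free_energy \<mu> k E \<beta> n) \<le> ?\<delta> n"
      using eventually_ge_at_top[of "max k 2"]
    proof eventually_elim
      case (elim n)
      then show ?case
        unfolding real_norm_def by (intro psi_minus_free_energy[OF \<mu> E]) simp_all
    qed
  qed
  moreover have "(\<lambda>n. (1 - 1 / real n) * free_energy \<mu> k E \<beta> n) \<longlonglongrightarrow> (1 - 0) * lim (free_energy \<mu> k E \<beta>)"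
    using convergent_free_energy[OF \<mu>(1,2) E, of \<beta>]
    by (intro tendsto_mult tendsto_diff tendsto_const lim_const_over_n) (simp add: convergent_LIMSEQ_iff)
  ultimately have "(\<lambda>n. (psi \<mu> k E \<beta> n - (1 - 1 / real n) * free_energy \<mu> k E \<beta> n)
      + (1 - 1 / real n) * free_energy \<mu> k E \<beta> n) \<longlonglongrightarrow> 0 + (1 - 0) * lim (free_energy \<mu> k E \<beta>)"
    by (rule tendsto_add)
  then show ?thesis by simp
qed

section \<open>Bounds on the limit\<close>

text \<open>
  \<open>\<beta>\<^sub>2 \<ge> 0\<close> allows replacing \<open>t(H\<^sub>2)\<close> by the larger edge density, and then \<open>\<beta>\<^sub>1 + \<beta>\<^sub>2 \<ge> 0\<close>
  allows replacing the edge density by 1.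
\<close>
lemma psi_le:
  assumes \<mu>: "prob_space \<mu>" "sets \<mu> = sets borel" "AE x in \<mu>. x \<in> {0..1}"
    and E: "simple_graph k E" "E \<noteq> {}" and n: "n > 0"
    and \<beta>: "snd \<beta> \<ge> 0" "fst \<beta> + snd \<beta> \<ge> 0"
  shows "psi \<mu> k E \<beta> n \<le> fst \<beta> + snd \<beta>"
proof -
  let ?G = "weighted_graph_measure \<mu> n"
  interpret prob_space ?G by (rule prob_space_weighted_graph_measure[OF \<mu>(1)])
  define X where "X g = (real n)\<^sup>2 * (fst \<beta> * hom_density 2 {(1, 2)} n g + snd \<beta> * hom_density k E n g)" for g
  note measurable_hom_density[OF \<mu>(2) E(1) n, measurable]
    measurable_hom_density[OF \<mu>(2) simple_graph_edge n, measurable]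
  have meas: "X \<in> borel_measurable ?G" unfolding X_def[abs_def] by measurable
  have X: "AE g in ?G. \<bar>X g\<bar> \<le> (real n)\<^sup>2 * (\<bar>fst \<beta>\<bar> + \<bar>snd \<beta>\<bar>) \<and> X g \<le> 0 + (real n)\<^sup>2 * (fst \<beta> + snd \<beta>)"
    using AE_weights_in_unit_interval[OF \<mu>(1,3), of n]
  proof eventually_elim
    case (elim g)
    then have g: "\<And>e. e \<in> vertex_pairs n \<Longrightarrow> g e \<in> {0..1}" by blast
    define s t where "s = hom_density 2 {(1, 2)} n g" and "t = hom_density k E n g"
    have s: "0 \<le> s" "s \<le> 1" and t: "0 \<le> t" "t \<le> 1" and ts: "t \<le> s"
      using hom_density_bounds[OF simple_graph_edge n g] hom_density_bounds[OF E(1) n g]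
        hom_density_le_edge_density[OF E g] by (simp_all add: s_def t_def)
    have "\<bar>fst \<beta> * s + snd \<beta> * t\<bar> \<le> \<bar>fst \<beta> * s\<bar> + \<bar>snd \<beta> * t\<bar>" by (rule abs_triangle_ineq)
    also have "\<dots> \<le> \<bar>fst \<beta>\<bar> + \<bar>snd \<beta>\<bar>"
      using s t by (intro add_mono) (auto simp: abs_mult mult_left_le)
    finally have 1: "\<bar>fst \<beta> * s + snd \<beta> * t\<bar> \<le> \<bar>fst \<beta>\<bar> + \<bar>snd \<beta>\<bar>" .
    have "fst \<beta> * s + snd \<beta> * t \<le> fst \<beta> * s + snd \<beta> * s"
      using ts \<beta> by (simp add: mult_left_mono)
    also have "\<dots> = (fst \<beta> + snd \<beta>) * s" by (simp add: distrib_right)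
    also have "\<dots> \<le> fst \<beta> + snd \<beta>" using s \<beta> by (simp add: mult_left_le)
    finally show ?case
      using 1 unfolding X_def s_def t_def abs_mult by (auto intro: mult_left_mono)
  qed
  have "ln (\<integral>g. exp (X g) \<partial>?G) \<le> ln (\<integral>g. exp 0 \<partial>?G) + (real n)\<^sup>2 * (fst \<beta> + snd \<beta>)"
  proof (rule ln_integral_exp_mono[OF meas])
    show "AE g in ?G. \<bar>X g\<bar> \<le> (real n)\<^sup>2 * (\<bar>fst \<beta>\<bar> + \<bar>snd \<beta>\<bar>)"
      "AE g in ?G. X g \<le> 0 + (real n)\<^sup>2 * (fst \<beta> + snd \<beta>)"
      using X by auto
    show "AE g in ?G. \<bar>0 :: real\<bar> \<le> 0" by simp
  qed simp
  then show ?thesis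
    using n unfolding psi_def X_def[symmetric] by (simp add: prob_space divide_le_eq mult.commute)
qed

lemma inj_density_complete:
  assumes E: "simple_graph k E" and kn: "k \<le> n"
  shows "inj_density k E n (\<lambda>e\<in>vertex_pairs n. 1) = 1"
proof -
  have "(\<Prod>(i, j)\<in>E. trunc_weight n (\<lambda>e\<in>vertex_pairs n. 1) (\<phi> i) (\<phi> j)) = 1"
    if \<phi>: "\<phi> \<in> injections k n" for \<phi>
  proof (rule prod.neutral, clarify)
    fix i j assume "(i, j) \<in> E"
    then have ij: "i \<in> {1..k}" "j \<in> {1..k}" "i \<noteq> j" using edge_in_range[OF E] by auto
    have "inj_on \<phi> {1..k}" "\<phi> \<in> {1..k} \<rightarrow>\<^sub>E {1..n}" using \<phi> by (simp_all add: injections_def)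
    then have "\<phi> i \<noteq> \<phi> j" "\<phi> i \<in> {1..n}" "\<phi> j \<in> {1..n}"
      using ij inj_onD PiE_mem by metis+
    then have "(\<phi> i, \<phi> j) \<in> vertex_pairs n \<or> (\<phi> j, \<phi> i) \<in> vertex_pairs n"
      unfolding vertex_pairs_def by simp linarith
    then have "edge_weight n (\<lambda>e\<in>vertex_pairs n. 1) (\<phi> i) (\<phi> j) = 1"
      unfolding edge_weight_def by auto
    then show "trunc_weight n (\<lambda>e\<in>vertex_pairs n. 1) (\<phi> i) (\<phi> j) = 1"
      by (simp add: trunc_weight_def)
  qed
  then show ?thesis using card_injections_pos[OF kn] by (simp add: inj_density_def)
qed

text \<open>
  The contribution of the single graph all of whose weights are 1. It has positive probability
  because of the atom, and its energy is exactly \<open>\<beta>\<^sub>1 + \<beta>\<^sub>2\<close>.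
\<close>
lemma free_energy_ge:
  assumes \<mu>: "prob_space \<mu>" "sets \<mu> = sets borel" and atom: "measure \<mu> {1} > 0"
    and E: "simple_graph k E" and n: "k \<le> n" "2 \<le> n"
  shows "fst \<beta> + snd \<beta> + ln (measure \<mu> {1}) \<le> free_energy \<mu> k E \<beta> n"
proof -
  let ?G = "weighted_graph_measure \<mu> n" and ?a = "measure \<mu> {1}"
  interpret \<mu>: prob_space \<mu> by fact
  interpret G: prob_space ?G by (rule prob_space_weighted_graph_measure[OF \<mu>(1)])
  interpret PM: finite_product_prob_space "\<lambda>_. \<mu>" "vertex_pairs n"
    by (intro finite_product_prob_space.intro product_prob_spaceI \<mu>(1))
      (unfold_locales, rule finite_vertex_pairs)
  define N where "N = n * (n - 1)"
  define S where "S = vertex_pairs n \<rightarrow>\<^sub>E {1 :: real}"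
  have N: "N > 0" using n by (simp add: N_def)
  note measurable_energy[OF \<mu>(2), measurable]
  have one: "{1} \<in> sets \<mu>" using \<mu>(2) by simp
  have S: "S \<in> sets ?G"
    unfolding S_def weighted_graph_measure_def using one by (intro sets_PiM_I_finite finite_vertex_pairs) auto
  have mS: "measure ?G S = ?a ^ card (vertex_pairs n)"
    unfolding S_def weighted_graph_measure_def using PM.prob_times[of "\<lambda>_. {1}"] one by simp
  have "?a ^ N \<le> ?a ^ card (vertex_pairs n)"
    using atom card_vertex_pairs_le by (intro power_decreasing) (auto simp: N_def)
  then have "exp (real N * (fst \<beta> + snd \<beta>)) * ?a ^ N \<le> exp (real N * (fst \<beta> + snd \<beta>)) * measure ?G S"
    unfolding mS by (intro mult_left_mono) auto
  also have "\<dots> = (\<integral>g. exp (real N * (fst \<beta> + snd \<beta>)) * indicator S g \<partial>?G)"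
    using S by (simp add: sets.Int_space_eq2)
  also have "\<dots> \<le> (\<integral>g. exp (real N * energy k E \<beta> n g) \<partial>?G)"
  proof (rule integral_mono)
    show "integrable ?G (\<lambda>g. exp (real N * (fst \<beta> + snd \<beta>)) * indicator S g :: real)"
      using S by (intro integrable_mult_right) (simp add: G.emeasure_eq_measure)
    show "integrable ?G (\<lambda>g. exp (real N * energy k E \<beta> n g))"
    proof (rule G.integrable_exp_bounded)
      show "AE g in ?G. \<bar>real N * energy k E \<beta> n g\<bar> \<le> real N * (\<bar>fst \<beta>\<bar> + \<bar>snd \<beta>\<bar>)"
        using abs_energy_le by (simp add: abs_mult mult_left_mono)
    qed measurable
    fix g
    show "exp (real N * (fst \<beta> + snd \<beta>)) * indicator S g \<le> exp (real N * energy k E \<beta> n g)"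
    proof (cases "g \<in> S")
      case True
      then have "g = (\<lambda>e\<in>vertex_pairs n. 1)"
        by (auto simp: S_def PiE_iff extensional_def fun_eq_iff)
      then have "energy k E \<beta> n g = fst \<beta> + snd \<beta>"
        using inj_density_complete[OF E n(1)] inj_density_complete[OF simple_graph_edge n(2)]
        by (simp add: energy_def)
      then show ?thesis using True by simp
    qed simp
  qed
  finally have "ln (exp (real N * (fst \<beta> + snd \<beta>)) * ?a ^ N) \<le> ln (\<integral>g. exp (real N * energy k E \<beta> n g) \<partial>?G)"
    using atom by (intro ln_mono) auto
  moreover have "ln (exp (real N * (fst \<beta> + snd \<beta>)) * ?a ^ N) = real N * (fst \<beta> + snd \<beta> + ln ?a)"
    using atom by (simp add: ln_mult ln_realpow distrib_left)
  ultimately show ?thesis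
    using N unfolding free_energy_def N_def[symmetric] by (simp add: le_divide_eq mult.commute)
qed

text \<open>
  The rate function at 1 is the supremum of \<open>- ln (E exp (\<theta> (X - 1)))\<close> over \<open>\<theta>\<close>. As \<open>X \<le> 1\<close>, the
  expectation tends to \<open>\<mu>{1}\<close> for \<open>\<theta> \<rightarrow> \<infinity>\<close> by dominated convergence, so it would tend to 0 and
  the rate would be infinite if there were no atom.
\<close>
lemma atom_of_finite_rate:
  assumes \<mu>: "prob_space \<mu>" "sets \<mu> = sets borel" "AE x in \<mu>. x \<in> {0..1}"
    and rate: "cramer_rate \<mu> 1 \<le> ereal C"
  shows "measure \<mu> {1} > 0"
proof -
  interpret prob_space \<mu> by fact
  note meas = measurable_cong_sets[OF \<mu>(2) refl, of borel]
  have ge: "exp (- C) \<le> (\<integral>x. exp (\<theta> * (x - 1)) \<partial>\<mu>)" for \<theta>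
  proof -
    have "ereal (\<theta> * 1 - cumulant \<mu> \<theta>) \<le> ereal C"
      using rate unfolding cramer_rate_def by (rule order.trans[OF SUP_upper[OF UNIV_I]])
    then have "\<theta> - C \<le> cumulant \<mu> \<theta>" by simp
    moreover have pos: "0 < (\<integral>x. exp (\<theta> * x) \<partial>\<mu>)"
    proof (rule integral_exp_pos)
      show "AE x in \<mu>. \<bar>\<theta> * x\<bar> \<le> \<bar>\<theta>\<bar>"
        using \<mu>(3) by eventually_elim (auto simp: abs_mult mult_left_le)
    qed (simp add: meas)
    ultimately have "exp (\<theta> - C) \<le> (\<integral>x. exp (\<theta> * x) \<partial>\<mu>)"
      by (simp add: cumulant_def ln_ge_iff)
    also have "\<dots> = (\<integral>x. exp \<theta> * exp (\<theta> * (x - 1)) \<partial>\<mu>)"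
      by (simp add: right_diff_distrib flip: exp_add)
    also have "\<dots> = exp \<theta> * (\<integral>x. exp (\<theta> * (x - 1)) \<partial>\<mu>)" by simp
    also have "exp (\<theta> - C) = exp \<theta> * exp (- C)" by (simp flip: exp_add)
    finally have "exp \<theta> * exp (- C) \<le> exp \<theta> * (\<integral>x. exp (\<theta> * (x - 1)) \<partial>\<mu>)" .
    then show ?thesis by simp
  qed
  have "(\<lambda>n. \<integral>x. exp (real n * (x - 1)) \<partial>\<mu>) \<longlonglongrightarrow> (\<integral>x. indicator {1} x \<partial>\<mu>)"
  proof (rule integral_dominated_convergence[where w = "\<lambda>_. 1"])
    show "AE x in \<mu>. (\<lambda>n. exp (real n * (x - 1))) \<longlonglongrightarrow> (indicator {1} x :: real)"
      using \<mu>(3)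
    proof eventually_elim
      case (elim x)
      show ?case
      proof (cases "x = 1")
        case False
        then have "exp (x - 1) < 1" using elim by simp
        then have "(\<lambda>n. exp (x - 1) ^ n) \<longlonglongrightarrow> 0" by (intro LIMSEQ_power_zero) simp
        then show ?thesis using False by (simp add: exp_of_nat_mult)
      qed simp
    qed
    show "AE x in \<mu>. norm (exp (real n * (x - 1))) \<le> 1" for n
      using \<mu>(3) by eventually_elim (auto simp: mult_le_0_iff)
  qed (auto simp: meas)
  then have "exp (- C) \<le> (\<integral>x. indicator {1} x \<partial>\<mu>)"
    by (rule LIMSEQ_le_const) (use ge in auto)
  then show ?thesis
    using \<mu>(2) sets_eq_imp_space_eq[OF \<mu>(2)] less_le_trans[OF exp_gt_zero[of "- C"]] by simp
qed

lemma psi_inf_bounds: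
  assumes \<mu>: "prob_space \<mu>" "sets \<mu> = sets borel" "AE x in \<mu>. x \<in> {0..1}" and atom: "measure \<mu> {1} > 0"
    and E: "simple_graph k E" "E \<noteq> {}"
    and \<beta>: "snd \<beta> \<ge> 0" "fst \<beta> + snd \<beta> \<ge> 0"
  shows "fst \<beta> + snd \<beta> + ln (measure \<mu> {1}) \<le> psi_inf \<mu> k E \<beta>" "psi_inf \<mu> k E \<beta> \<le> fst \<beta> + snd \<beta>"
proof -
  have lim: "psi \<mu> k E \<beta> \<longlonglongrightarrow> lim (free_energy \<mu> k E \<beta>)"
    by (rule psi_tendsto_lim_free_energy[OF \<mu> E(1)])
  then have eq: "psi_inf \<mu> k E \<beta> = lim (free_energy \<mu> k E \<beta>)"
    unfolding psi_inf_def by (rule limI)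
  show "psi_inf \<mu> k E \<beta> \<le> fst \<beta> + snd \<beta>"
    unfolding eq by (rule LIMSEQ_le_const2[OF lim]) (use psi_le[OF \<mu> E _ \<beta>] in \<open>auto intro!: exI[of _ 1]\<close>)
  have "free_energy \<mu> k E \<beta> \<longlonglongrightarrow> lim (free_energy \<mu> k E \<beta>)"
    using convergent_free_energy[OF \<mu>(1,2) E(1), of \<beta>] by (simp add: convergent_LIMSEQ_iff)
  then show "fst \<beta> + snd \<beta> + ln (measure \<mu> {1}) \<le> psi_inf \<mu> k E \<beta>"
    unfolding eq
  proof (rule LIMSEQ_le_const, intro exI allI impI)
    fix n assume "max k 2 \<le> n"
    then show "fst \<beta> + snd \<beta> + ln (measure \<mu> {1}) \<le> free_energy \<mu> k E \<beta> n"
      by (intro free_energy_ge[OF \<mu>(1,2) atom E(1)]) auto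
  qed
qed

lemma eventually_far_from_origin:
  "\<forall>\<^sub>F \<beta> in far_from_origin. snd \<beta> \<ge> 0"
  "filterlim (\<lambda>\<beta>. fst \<beta> + snd \<beta>) at_top far_from_origin"
proof -
  have "\<forall>\<^sub>F \<beta> in principal {\<beta>. fst \<beta> > - snd \<beta> \<and> snd \<beta> \<ge> (0::real)}. snd \<beta> \<ge> 0"
    unfolding eventually_principal by blast
  then show "\<forall>\<^sub>F \<beta> in far_from_origin. snd \<beta> \<ge> 0"
    unfolding far_from_origin_def
    by (rule filter_leD[rotated]) (simp add: le_infI1 le_infI2)
  show "filterlim (\<lambda>\<beta>. fst \<beta> + snd \<beta>) at_top far_from_origin"
    unfolding far_from_origin_def by (rule filterlim_mono[OF filterlim_filtercomap]) auto
qed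

theorem theorem7:
  fixes \<mu> :: "real measure" and k p :: nat and E :: "(nat \<times> nat) set"
  assumes "prob_space \<mu>"
    and "sets \<mu> = sets borel"
    and nondegenerate: "\<And>c. \<mu> \<noteq> return borel c"
    and supported: "AE x in \<mu>. x \<in> {0..1}"
    and symmetric: "distr \<mu> borel (\<lambda>x. 1 - x) = \<mu>"
    and rate_bounded: "\<exists>C::real. \<forall>u\<in>{0..1}. cramer_rate \<mu> u \<le> ereal C"
    and "simple_graph k E"
    and "card E = p"
    and "p \<ge> 2"
    and one_zero: "\<exists>!\<theta>::real.
      (deriv ^^ 3) (cumulant \<mu>) \<theta> * deriv (cumulant \<mu>) \<theta>
        = - (real p - 2) * ((deriv ^^ 2) (cumulant \<mu>) \<theta>)\<^sup>2"
  shows "((\<lambda>\<beta>. psi_inf \<mu> k E \<beta> / (fst \<beta> + snd \<beta>)) \<longlongrightarrow> 1) far_from_origin"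
proof -
  obtain C where "cramer_rate \<mu> 1 \<le> ereal C" using rate_bounded by fastforce
  then have atom: "measure \<mu> {1} > 0"
    by (rule atom_of_finite_rate[OF assms(1,2) supported])
  have "E \<noteq> {}" using \<open>card E = p\<close> \<open>p \<ge> 2\<close> by auto
  note bounds = psi_inf_bounds[OF assms(1,2) supported atom \<open>simple_graph k E\<close> this]
  have pos: "\<forall>\<^sub>F \<beta> in far_from_origin. fst \<beta> + snd \<beta> > 0"
    using eventually_far_from_origin(2) by (simp add: filterlim_at_top_dense)
  show ?thesis
  proof (rule tendsto_sandwich)
    show "\<forall>\<^sub>F \<beta> in far_from_origin. 1 + ln (measure \<mu> {1}) / (fst \<beta> + snd \<beta>) \<le> psi_inf \<mu> k E \<beta> / (fst \<beta> + snd \<beta>)"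
      using pos eventually_far_from_origin(1)
    proof eventually_elim
      case (elim \<beta>)
      then have "(fst \<beta> + snd \<beta> + ln (measure \<mu> {1})) / (fst \<beta> + snd \<beta>) \<le> psi_inf \<mu> k E \<beta> / (fst \<beta> + snd \<beta>)"
        using bounds(1)[of \<beta>] by (intro divide_right_mono) auto
      then show ?case using elim by (simp add: add_divide_distrib)
    qed
    show "\<forall>\<^sub>F \<beta> in far_from_origin. psi_inf \<mu> k E \<beta> / (fst \<beta> + snd \<beta>) \<le> 1"
      using pos eventually_far_from_origin(1) by eventually_elim (use bounds(2) in auto)
    have "((\<lambda>\<beta>. 1 + ln (measure \<mu> {1}) / (fst \<beta> + snd \<beta>)) \<longlongrightarrow> 1 + 0) far_from_origin"
      by (intro tendsto_add tendsto_const real_tendsto_divide_at_top[OF tendsto_const eventually_far_from_origin(2)])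
    then show "((\<lambda>\<beta>. 1 + ln (measure \<mu> {1}) / (fst \<beta> + snd \<beta>)) \<longlongrightarrow> 1) far_from_origin" by simp
  qed simp
qed

end
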